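(* Let $\mathscr M\subset ba(\mathcal A)$ be norm bounded. Then conditions (i)–(v) below are mutually equivalent and imply (vi). If $\mathcal A$ is a $\sigma$-algebra and $\mathscr M\subset ca(\mathcal A)$, then (vi) implies (iii) (so all six are equivalent). (i) $\lim_{m(A)\to0}\sup_{\mu\in\mathscr M}|\mu|(A)=0$ for some $m\in\mathbf A(\mathscr M)$; (ii) $\mathscr M$ is relatively weakly compact in the Banach space $ba(\mathcal A)$; (iii) $\{|\mu|:\mu\in\mathscr M\}$ is uniformly monotone continuous: for every monotone sequence $(A_n)$ in $\mathcal A$, $\lim_n|\mu|(A_n)$ exists uniformly in $\mu\in\mathscr M$; (iv) for each $\mathscr M_0\subset\mathscr M$ and each sequence $(A_n)$ in $\mathcal A$ such that $\lim_j\lim_k|\mu|\big(\bigcup_{n=j}^{j+k}A_n\big)=0$ for every $\mu\in\mathscr M_0$, one has $\mu(A_n)\to0$ uniformly in $\mu\in\mathscr M_0$; (v) (uniform absolute continuity property) whenever $\mathscr M_0\subset\mathscr M$, $\lambda\in ba(\mathcal A)$ and $\mu\ll\lambda$ for all $\mu\in\mathscr M_0$, then $\lim_{|\lambda|(A)\to0}\sup_{\mu\in\mathscr M_0}|\mu|(A)=0$; (vi) (uniform orthogonality property) whenever $\mathscr M_0\subset\mathscr M$, $\lambda\in ba(\mathcal A)$ and $\lambda\perp\mu$ for all $\mu\in\mathscr M_0$, then for every $\varepsilon>0$ there is $A\in\mathcal A$ with $\sup_{\mu\in\mathscr M_0}|\mu|(A)+|\lambda|(A^c)<\varepsilon$.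
   Context: $\mathcal A$ is an algebra of subsets of $\Omega$; $ba(\mathcal A)$ the Banach space of bounded finitely additive real set functions on $\mathcal A$ with $\|\mu\|=|\mu|(\Omega)$, $|\mu|$ total variation; $ca(\mathcal A)$ its countably additive elements. $\mu\ll\lambda$: for every $\varepsilon>0$ there is $\delta>0$ with $|\lambda|(A)<\delta\Rightarrow|\mu|(A)<\varepsilon$. $\mu\perp\lambda$: for every $\varepsilon>0$ there is $A\in\mathcal A$ with $|\mu|(A)+|\lambda|(A^c)<\varepsilon$. $\mathbf A(\mathscr M)=\{\sum_n\alpha_n\frac{|\mu_n|}{1\vee\|\mu_n\|}:\mu_n\in\mathscr M,\ \alpha_n\ge0,\ \sum_n\alpha_n=1\}$. *)

theory Defs
  imports "HOL-Analysis.Analysis"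
begin

text \<open>Set functions on an algebra \<A> of subsets of \<Omega> are represented as real-valued
functions on all sets, required to vanish off \<A> (so that ba is a real vector space
of functions).\<close>

definition fin_additive :: "'a set set \<Rightarrow> ('a set \<Rightarrow> real) \<Rightarrow> bool" where
  "fin_additive \<A> \<mu> \<longleftrightarrow>
     (\<forall>A\<in>\<A>. \<forall>B\<in>\<A>. A \<inter> B = {} \<longrightarrow> \<mu> (A \<union> B) = \<mu> A + \<mu> B)"

definition tvar :: "'a set set \<Rightarrow> ('a set \<Rightarrow> real) \<Rightarrow> 'a set \<Rightarrow> real" where
  "tvar \<A> \<mu> A = Sup {(\<Sum>B\<in>P. \<bar>\<mu> B\<bar>) | P. finite P \<and> P \<subseteq> \<A> \<and> pairwise disjnt P \<and> \<Union>P = A}"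

definition ba :: "'a set \<Rightarrow> 'a set set \<Rightarrow> ('a set \<Rightarrow> real) set" where
  "ba \<Omega> \<A> = {\<mu>. (\<forall>B. B \<notin> \<A> \<longrightarrow> \<mu> B = 0) \<and> fin_additive \<A> \<mu> \<and>
                 (\<exists>C. \<forall>B\<in>\<A>. \<bar>\<mu> B\<bar> \<le> C)}"

definition ba_norm :: "'a set \<Rightarrow> 'a set set \<Rightarrow> ('a set \<Rightarrow> real) \<Rightarrow> real" where
  "ba_norm \<Omega> \<A> \<mu> = tvar \<A> \<mu> \<Omega>"

definition ca :: "'a set \<Rightarrow> 'a set set \<Rightarrow> ('a set \<Rightarrow> real) set" where
  "ca \<Omega> \<A> = {\<mu> \<in> ba \<Omega> \<A>. \<forall>F::nat \<Rightarrow> 'a set. range F \<subseteq> \<A> \<longrightarrow> disjoint_family F \<longrightarrow>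
                   (\<Union>n. F n) \<in> \<A> \<longrightarrow> (\<lambda>n. \<mu> (F n)) sums \<mu> (\<Union>n. F n)}"

definition abs_cont :: "'a set set \<Rightarrow> ('a set \<Rightarrow> real) \<Rightarrow> ('a set \<Rightarrow> real) \<Rightarrow> bool" where
  "abs_cont \<A> \<mu> lam \<longleftrightarrow>
     (\<forall>\<epsilon>>0. \<exists>\<delta>>0. \<forall>A\<in>\<A>. tvar \<A> lam A < \<delta> \<longrightarrow> tvar \<A> \<mu> A < \<epsilon>)"

definition orth :: "'a set \<Rightarrow> 'a set set \<Rightarrow> ('a set \<Rightarrow> real) \<Rightarrow> ('a set \<Rightarrow> real) \<Rightarrow> bool" where
  "orth \<Omega> \<A> \<mu> lam \<longleftrightarrow>
     (\<forall>\<epsilon>>0. \<exists>A\<in>\<A>. tvar \<A> \<mu> A + tvar \<A> lam (\<Omega> - A) < \<epsilon>)"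

definition convA :: "'a set \<Rightarrow> 'a set set \<Rightarrow> ('a set \<Rightarrow> real) set \<Rightarrow> ('a set \<Rightarrow> real) set" where
  "convA \<Omega> \<A> M = {(\<lambda>A. \<Sum>n. \<alpha> n * (tvar \<A> (\<mu> n) A / max 1 (ba_norm \<Omega> \<A> (\<mu> n)))) |
       \<alpha> \<mu>. (\<forall>n. \<mu> n \<in> M) \<and> (\<forall>n. \<alpha> n \<ge> 0) \<and> \<alpha> sums 1}"

definition ba_dual :: "'a set \<Rightarrow> 'a set set \<Rightarrow> (('a set \<Rightarrow> real) \<Rightarrow> real) set" where
  "ba_dual \<Omega> \<A> = {\<phi>. (\<forall>\<mu>\<in>ba \<Omega> \<A>. \<forall>\<nu>\<in>ba \<Omega> \<A>. \<forall>a b.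
                      \<phi> (\<lambda>B. a * \<mu> B + b * \<nu> B) = a * \<phi> \<mu> + b * \<phi> \<nu>) \<and>
                   (\<exists>C. \<forall>\<mu>\<in>ba \<Omega> \<A>. \<bar>\<phi> \<mu>\<bar> \<le> C * ba_norm \<Omega> \<A> \<mu>)}"

definition ba_weak :: "'a set \<Rightarrow> 'a set set \<Rightarrow> ('a set \<Rightarrow> real) topology" where
  "ba_weak \<Omega> \<A> = topology_generated_by
     {{\<mu> \<in> ba \<Omega> \<A>. \<phi> \<mu> \<in> U} | \<phi> U. \<phi> \<in> ba_dual \<Omega> \<A> \<and> open U}"

definition rel_weakly_compact :: "'a set \<Rightarrow> 'a set set \<Rightarrow> ('a set \<Rightarrow> real) set \<Rightarrow> bool" where
  "rel_weakly_compact \<Omega> \<A> M \<longleftrightarrow>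
     M \<subseteq> ba \<Omega> \<A> \<and> compactin (ba_weak \<Omega> \<A>) (ba_weak \<Omega> \<A> closure_of M)"

end

theory Submission
  imports Defs
begin

text \<open>Conditions (i)--(v) are each equivalent to uniform strong additivity (\<open>usa\<close>): \<open>|\<mu>|(D\<^sub>n) \<rightarrow> 0\<close> uniformly
on \<open>M\<close> for every disjoint sequence. Under it, finitely many members of \<open>M\<close> control all of \<open>M\<close> up to \<open>\<epsilon>\<close>,
which yields (i), (iv), (v) and (vi) at once. Weak compactness gives it by Schur's sliding hump argument,
since \<open>\<mu> \<mapsto> (\<mu>(D\<^sub>n))\<^sub>n\<close> maps \<open>ba\<close> into \<open>\<ell>\<^sup>1\<close>. Conversely, if \<open>M\<close> is bounded and uniformly absolutely
continuous with respect to \<open>m\<close>, then \<open>M\<close> lies in a set that is compact for setwise convergence, and on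
which every \<open>\<phi>\<close> in the dual is a uniform limit of finite combinations of evaluations \<open>\<mu> \<mapsto> \<mu>(E)\<close>; hence
the weak and the setwise topologies agree there.\<close>

text \<open>\<open>\<A>\<close> is closed only under finite operations and its charges are only
  finitely additive, so infinite tail unions and Radon-Nikodym densities are not at hand. Tails are
  therefore cut at a finite stage, with an error that strong additivity controls uniformly, and
  densities become step functions on finite partitions. A Hahn decomposition may fail to exist as
  well, so positive parts are defined by a supremum. Strong additivity is a good pivot because it
  speaks of one disjoint sequence at a time: its failure is witnessed by countably many members of
  \<open>M\<close>, which a single series dominates, and it passes to subfamilies, which settles the
  quantifiers over \<open>M0\<close>. Neither the weak nor the setwise topology need be metrizable,
  so limits are taken as cluster points: points lying in every closed set that eventually contains
  the sequence. This bypasses the Eberlein-Smulian theorem; a convergent subsequence is extracted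
  only for the countably many coordinates \<open>\<mu>\<^sub>n(D\<^sub>j)\<close>.\<close>

locale set_alg = algebra \<Omega> \<A> for \<Omega> :: "'a set" and \<A> :: "'a set set"
begin

text \<open>\<open>ba\<close> without the condition of vanishing off \<open>\<A>\<close>: variations
  and the series below are bounded charges in this sense, but their values outside the algebra are
  not controlled.\<close>

definition bfa :: "('a set \<Rightarrow> real) \<Rightarrow> bool" where
  "bfa \<mu> \<longleftrightarrow> fin_additive \<A> \<mu> \<and> (\<exists>C. \<forall>B\<in>\<A>. \<bar>\<mu> B\<bar> \<le> C)"

definition nonneg :: "('a set \<Rightarrow> real) \<Rightarrow> bool" where
  "nonneg \<mu> \<longleftrightarrow> fin_additive \<A> \<mu> \<and> (\<forall>B\<in>\<A>. 0 \<le> \<mu> B)"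

text \<open>The Jordan positive part \<open>\<mu>\<^sup>+\<close>. It is also applied to v - K m, to
  measure how far v exceeds a multiple of m.\<close>

definition upvar :: "('a set \<Rightarrow> real) \<Rightarrow> 'a set \<Rightarrow> real" where
  "upvar \<mu> A = (SUP B\<in>{B\<in>\<A>. B \<subseteq> A}. \<mu> B)"

definition is_part :: "'a set \<Rightarrow> 'a set set \<Rightarrow> bool" where
  "is_part A P \<longleftrightarrow> finite P \<and> P \<subseteq> \<A> \<and> pairwise disjnt P \<and> \<Union>P = A"

section \<open>Elementary calculus of finitely additive set functions\<close>

lemma ba_iff: "\<mu> \<in> ba \<Omega> \<A> \<longleftrightarrow> (\<forall>B. B \<notin> \<A> \<longrightarrow> \<mu> B = 0) \<and> bfa \<mu>"
  by (auto simp: ba_def bfa_def)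

lemma ba_bfa: "\<mu> \<in> ba \<Omega> \<A> \<Longrightarrow> bfa \<mu>"
  by (simp add: ba_iff)

lemma fin_additiveD:
  "fin_additive \<A> \<mu> \<Longrightarrow> A \<in> \<A> \<Longrightarrow> B \<in> \<A> \<Longrightarrow> A \<inter> B = {} \<Longrightarrow> \<mu> (A \<union> B) = \<mu> A + \<mu> B"
  by (auto simp: fin_additive_def)

lemma fin_additive_empty: "fin_additive \<A> \<mu> \<Longrightarrow> \<mu> {} = 0"
  using fin_additiveD[of \<mu> "{}" "{}"] by simp

lemma fin_additive_Diff:
  assumes "fin_additive \<A> \<mu>" "A \<in> \<A>" "B \<in> \<A>" "B \<subseteq> A"
  shows "\<mu> (A - B) = \<mu> A - \<mu> B"
proof -
  have "\<mu> (B \<union> (A - B)) = \<mu> B + \<mu> (A - B)"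
    using assms by (intro fin_additiveD) auto
  moreover have "B \<union> (A - B) = A"
    using assms by auto
  ultimately show ?thesis
    by simp
qed

lemma fin_additive_UN:
  assumes "fin_additive \<A> \<mu>" "finite I" "\<And>i. i \<in> I \<Longrightarrow> F i \<in> \<A>" "disjoint_family_on F I"
  shows "\<mu> (\<Union>i\<in>I. F i) = (\<Sum>i\<in>I. \<mu> (F i))"
  using assms(2,3,4)
proof (induction I rule: finite_induct)
  case empty
  then show ?case
    using fin_additive_empty[OF assms(1)] by simp
next
  case (insert i I)
  have "\<mu> (F i \<union> (\<Union>i\<in>I. F i)) = \<mu> (F i) + \<mu> (\<Union>i\<in>I. F i)"
    using insert by (intro fin_additiveD[OF assms(1)]) (auto simp: disjoint_family_on_def)
  moreover have "disjoint_family_on F I"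
    using insert.prems by (auto simp: disjoint_family_on_def)
  ultimately show ?case
    using insert by simp
qed

lemma fin_additive_part:
  assumes "fin_additive \<A> \<mu>" "is_part B P" "A \<in> \<A>" "A \<subseteq> B"
  shows "(\<Sum>E\<in>P. \<mu> (A \<inter> E)) = \<mu> A"
proof -
  have "disjoint_family_on (\<lambda>E. A \<inter> E) P"
    using assms(2) by (auto simp: disjoint_family_on_def is_part_def pairwise_def disjnt_def)
  moreover have "(\<Union>E\<in>P. A \<inter> E) = A"
    using assms by (auto simp: is_part_def)
  moreover have "finite P" "\<And>E. E \<in> P \<Longrightarrow> A \<inter> E \<in> \<A>"
    using assms(2,3) by (auto simp: is_part_def)
  ultimately show ?thesis
    using fin_additive_UN[OF assms(1), of P "\<lambda>E. A \<inter> E"] by simp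
qed

lemma fin_additive_part':
  assumes "fin_additive \<A> \<mu>" "is_part B P"
  shows "(\<Sum>E\<in>P. \<mu> E) = \<mu> B"
proof -
  have "disjoint_family_on (\<lambda>E. E) P"
    using assms(2) by (auto simp: disjoint_family_on_def is_part_def pairwise_def disjnt_def)
  moreover have "finite P" "\<And>E. E \<in> P \<Longrightarrow> E \<in> \<A>" "\<Union>P = B"
    using assms(2) by (auto simp: is_part_def)
  ultimately show ?thesis
    using fin_additive_UN[OF assms(1), of P "\<lambda>E. E"] by simp
qed

lemma bfa_add: "bfa \<mu> \<Longrightarrow> fin_additive \<A> \<mu>"
  by (simp add: bfa_def)

lemma bfa_bound:
  assumes "bfa \<mu>"
  obtains C where "\<And>B. B \<in> \<A> \<Longrightarrow> \<bar>\<mu> B\<bar> \<le> C"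
  using assms by (auto simp: bfa_def)

lemma fin_additive_lincomb:
  "fin_additive \<A> \<mu> \<Longrightarrow> fin_additive \<A> \<nu> \<Longrightarrow> fin_additive \<A> (\<lambda>B. a * \<mu> B + b * \<nu> B)"
  by (auto simp: fin_additive_def algebra_simps)

lemma bfa_lincomb:
  assumes "bfa \<mu>" "bfa \<nu>"
  shows "bfa (\<lambda>B. a * \<mu> B + b * \<nu> B)"
proof -
  obtain C D where C: "\<And>B. B \<in> \<A> \<Longrightarrow> \<bar>\<mu> B\<bar> \<le> C" and D: "\<And>B. B \<in> \<A> \<Longrightarrow> \<bar>\<nu> B\<bar> \<le> D"
    using assms bfa_bound by metis
  have "\<bar>a * \<mu> B + b * \<nu> B\<bar> \<le> \<bar>a\<bar> * C + \<bar>b\<bar> * D" if "B \<in> \<A>" for B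
  proof -
    have "\<bar>a * \<mu> B + b * \<nu> B\<bar> \<le> \<bar>a\<bar> * \<bar>\<mu> B\<bar> + \<bar>b\<bar> * \<bar>\<nu> B\<bar>"
      by (metis abs_mult abs_triangle_ineq)
    also have "\<dots> \<le> \<bar>a\<bar> * C + \<bar>b\<bar> * D"
      using C[OF that] D[OF that] by (intro add_mono mult_left_mono) auto
    finally show ?thesis .
  qed
  then show ?thesis
    using fin_additive_lincomb[of \<mu> \<nu> a b] assms by (auto simp: bfa_def)
qed

lemma bfa_diff:
  assumes "bfa \<mu>" "bfa \<nu>"
  shows "bfa (\<lambda>B. \<mu> B - \<nu> B)"
  using bfa_lincomb[OF assms, of 1 "-1"] by simp

lemma nonneg_add: "nonneg \<mu> \<Longrightarrow> fin_additive \<A> \<mu>"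
  by (simp add: nonneg_def)

lemma nonneg_ge: "nonneg \<mu> \<Longrightarrow> B \<in> \<A> \<Longrightarrow> 0 \<le> \<mu> B"
  by (simp add: nonneg_def)

lemma nonneg_mono:
  assumes "nonneg \<mu>" "A \<in> \<A>" "B \<in> \<A>" "A \<subseteq> B"
  shows "\<mu> A \<le> \<mu> B"
  using fin_additive_Diff[OF nonneg_add[OF assms(1)] assms(3,2,4)] nonneg_ge[OF assms(1), of "B - A"] assms
  by auto

lemma nonneg_subadd:
  assumes "nonneg \<mu>" "A \<in> \<A>" "B \<in> \<A>"
  shows "\<mu> (A \<union> B) \<le> \<mu> A + \<mu> B"
proof -
  have "\<mu> (A \<union> (B - A)) = \<mu> A + \<mu> (B - A)"
    using assms by (intro fin_additiveD nonneg_add) auto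
  moreover have "\<mu> (B - A) \<le> \<mu> B"
    using assms by (intro nonneg_mono) auto
  ultimately show ?thesis
    by simp
qed

lemma nonneg_subadd_UN:
  assumes "nonneg \<mu>" "finite I" "\<And>i. i \<in> I \<Longrightarrow> F i \<in> \<A>"
  shows "\<mu> (\<Union>i\<in>I. F i) \<le> (\<Sum>i\<in>I. \<mu> (F i))"
  using assms(2,3)
proof (induction I rule: finite_induct)
  case empty
  then show ?case
    using fin_additive_empty[OF nonneg_add[OF assms(1)]] by simp
next
  case (insert i I)
  have "\<mu> (F i \<union> (\<Union>i\<in>I. F i)) \<le> \<mu> (F i) + \<mu> (\<Union>i\<in>I. F i)"
    using insert by (intro nonneg_subadd assms(1)) auto
  then show ?case
    using insert by auto
qed

lemma nonneg_bfa:
  assumes "nonneg \<mu>"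
  shows "bfa \<mu>"
  unfolding bfa_def
proof (intro conjI exI ballI)
  fix B assume B: "B \<in> \<A>"
  then have "B \<subseteq> \<Omega>"
    by (rule sets_into_space)
  then show "\<bar>\<mu> B\<bar> \<le> \<mu> \<Omega>"
    using nonneg_mono[OF assms B top] nonneg_ge[OF assms B] by simp
qed (use assms nonneg_add in auto)

lemma nonneg_disjoint_summable:
  assumes "nonneg \<mu>" "range D \<subseteq> \<A>" "disjoint_family D"
  shows "summable (\<lambda>n::nat. \<mu> (D n))"
proof (rule summableI_nonneg_bounded)
  show "0 \<le> \<mu> (D n)" for n
    using assms by (auto intro: nonneg_ge)
  fix n
  have "(\<Sum>i<n. \<mu> (D i)) = \<mu> (\<Union>i<n. D i)"
    using assms by (intro fin_additive_UN[symmetric] nonneg_add)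
      (auto simp: disjoint_family_on_def)
  also have "\<dots> \<le> \<mu> \<Omega>"
    using assms sets_into_space by (intro nonneg_mono) blast+
  finally show "(\<Sum>i<n. \<mu> (D i)) \<le> \<mu> \<Omega>" .
qed

lemma nonneg_disjoint_tendsto:
  assumes "nonneg \<mu>" "range D \<subseteq> \<A>" "disjoint_family D"
  shows "(\<lambda>n::nat. \<mu> (D n)) \<longlonglongrightarrow> 0"
  by (rule summable_LIMSEQ_zero[OF nonneg_disjoint_summable[OF assms]])

section \<open>Upper variation and total variation\<close>

lemma upvar_ge:
  assumes "bfa \<mu>" "B \<in> \<A>" "B \<subseteq> A"
  shows "\<mu> B \<le> upvar \<mu> A"
proof -
  obtain C where "\<And>B. B \<in> \<A> \<Longrightarrow> \<bar>\<mu> B\<bar> \<le> C"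
    using assms(1) bfa_bound by metis
  then have "bdd_above (\<mu> ` {B \<in> \<A>. B \<subseteq> A})"
    by (intro bdd_aboveI[of _ C]) force
  then show ?thesis
    unfolding upvar_def using assms by (intro cSUP_upper) auto
qed

lemma upvar_le:
  assumes "\<And>B. B \<in> \<A> \<Longrightarrow> B \<subseteq> A \<Longrightarrow> \<mu> B \<le> s"
  shows "upvar \<mu> A \<le> s"
  unfolding upvar_def using assms by (intro cSUP_least) auto

text \<open>A subset of a disjoint union is the union of two independently chosen subsets of the
  parts, so the supremum splits into a sum.\<close>

lemma upvar_nonneg:
  assumes "bfa \<mu>"
  shows "nonneg (upvar \<mu>)"
  unfolding nonneg_def
proof
  show "\<forall>B\<in>\<A>. 0 \<le> upvar \<mu> B"
    using upvar_ge[OF assms, of "{}"] fin_additive_empty[OF bfa_add[OF assms]] by auto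
  show "fin_additive \<A> (upvar \<mu>)"
    unfolding fin_additive_def
  proof (intro ballI impI antisym)
    fix A B assume AB: "A \<in> \<A>" "B \<in> \<A>" "A \<inter> B = {}"
    show "upvar \<mu> (A \<union> B) \<le> upvar \<mu> A + upvar \<mu> B"
    proof (rule upvar_le)
      fix E assume E: "E \<in> \<A>" "E \<subseteq> A \<union> B"
      have "\<mu> ((E \<inter> A) \<union> (E \<inter> B)) = \<mu> (E \<inter> A) + \<mu> (E \<inter> B)"
        using AB E by (intro fin_additiveD bfa_add assms) auto
      moreover have "(E \<inter> A) \<union> (E \<inter> B) = E"
        using E by auto
      ultimately show "\<mu> E \<le> upvar \<mu> A + upvar \<mu> B"
        using upvar_ge[OF assms, of "E \<inter> A" A] upvar_ge[OF assms, of "E \<inter> B" B]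
          Int[OF E(1) AB(1)] Int[OF E(1) AB(2)] by simp
    qed
    have "upvar \<mu> A \<le> upvar \<mu> (A \<union> B) - upvar \<mu> B"
    proof (rule upvar_le)
      fix E assume E: "E \<in> \<A>" "E \<subseteq> A"
      have "upvar \<mu> B \<le> upvar \<mu> (A \<union> B) - \<mu> E"
      proof (rule upvar_le)
        fix F assume F: "F \<in> \<A>" "F \<subseteq> B"
        have "\<mu> (E \<union> F) = \<mu> E + \<mu> F"
          using AB E F by (intro fin_additiveD bfa_add assms) auto
        then show "\<mu> F \<le> upvar \<mu> (A \<union> B) - \<mu> E"
          using upvar_ge[OF assms Un[OF E(1) F(1)], of "A \<union> B"] E F by fastforce
      qed
      then show "\<mu> E \<le> upvar \<mu> (A \<union> B) - upvar \<mu> B"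
        by simp
    qed
    then show "upvar \<mu> A + upvar \<mu> B \<le> upvar \<mu> (A \<union> B)"
      by simp
  qed
qed

lemma tvar_eq_SUP: "tvar \<A> \<mu> A = (SUP P\<in>{P. is_part A P}. \<Sum>B\<in>P. \<bar>\<mu> B\<bar>)"
  unfolding tvar_def is_part_def by (rule arg_cong[where f = Sup]) auto

text \<open>On each block |x| = 2 max(x, 0) - x, and the union of the blocks of nonnegative mass
  competes in the supremum \<open>upvar\<close>.\<close>

lemma part_sum_le:
  assumes "bfa \<mu>" "is_part A P"
  shows "(\<Sum>B\<in>P. \<bar>\<mu> B\<bar>) \<le> 2 * upvar \<mu> A - \<mu> A"
proof -
  let ?p = "{B \<in> P. 0 \<le> \<mu> B}"
  have fin: "finite P" and P: "P \<subseteq> \<A>" "\<Union>P = A" "pairwise disjnt P"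
    using assms(2) by (auto simp: is_part_def)
  have part: "is_part (\<Union>?p) ?p"
    using fin P by (auto simp: is_part_def intro: pairwise_subset)
  have "(\<Sum>B\<in>P. \<bar>\<mu> B\<bar>) = (\<Sum>B\<in>P. 2 * (if 0 \<le> \<mu> B then \<mu> B else 0) - \<mu> B)"
    by (intro sum.cong) auto
  also have "\<dots> = 2 * (\<Sum>B\<in>?p. \<mu> B) - (\<Sum>B\<in>P. \<mu> B)"
    using fin by (simp add: sum_subtractf sum_distrib_left[symmetric] sum.inter_filter)
  also have "\<dots> = 2 * \<mu> (\<Union>?p) - \<mu> A"
    using fin_additive_part'[OF bfa_add[OF assms(1)]] part assms(2) by simp
  also have "\<dots> \<le> 2 * upvar \<mu> A - \<mu> A"
  proof -
    have "\<Union>?p \<in> \<A>"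
      using fin P by (intro finite_Union) auto
    then show ?thesis
      using upvar_ge[OF assms(1), of "\<Union>?p" A] P by auto
  qed
  finally show ?thesis .
qed

lemma is_part_single: "A \<in> \<A> \<Longrightarrow> is_part A {A}"
  by (auto simp: is_part_def)

lemma part_sum_le_tvar:
  assumes "bfa \<mu>" "is_part A P"
  shows "(\<Sum>B\<in>P. \<bar>\<mu> B\<bar>) \<le> tvar \<A> \<mu> A"
  unfolding tvar_eq_SUP
  using part_sum_le[OF assms(1)] assms(2)
  by (intro cSUP_upper bdd_aboveI[of _ "2 * upvar \<mu> A - \<mu> A"]) auto

lemma tvar_le:
  assumes "A \<in> \<A>" "\<And>P. is_part A P \<Longrightarrow> (\<Sum>B\<in>P. \<bar>\<mu> B\<bar>) \<le> s"
  shows "tvar \<A> \<mu> A \<le> s"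
  unfolding tvar_eq_SUP using assms is_part_single by (intro cSUP_least) auto

text \<open>The two-block partition \<open>{B, A - B}\<close> shows that the variation is at least 2
  \<mu>(B) - \<mu>(A); then take the supremum over \<open>B\<close>. Through this form of the Jordan
  decomposition \<open>tvar\<close> inherits additivity from \<open>upvar\<close>.\<close>

lemma tvar_eq:
  assumes "bfa \<mu>" "A \<in> \<A>"
  shows "tvar \<A> \<mu> A = 2 * upvar \<mu> A - \<mu> A"
proof (rule antisym)
  show "tvar \<A> \<mu> A \<le> 2 * upvar \<mu> A - \<mu> A"
    using part_sum_le[OF assms(1)] by (intro tvar_le assms(2))
  have "upvar \<mu> A \<le> (tvar \<A> \<mu> A + \<mu> A) / 2"
  proof (rule upvar_le)
    fix B assume B: "B \<in> \<A>" "B \<subseteq> A"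
    have "is_part A {B, A - B}"
      using B assms(2) by (auto simp: is_part_def pairwise_def disjnt_def)
    then have le: "(\<Sum>B\<in>{B, A - B}. \<bar>\<mu> B\<bar>) \<le> tvar \<A> \<mu> A"
      by (rule part_sum_le_tvar[OF assms(1)])
    have "(\<Sum>B\<in>{B, A - B}. \<bar>\<mu> B\<bar>) = \<bar>\<mu> B\<bar> + \<bar>\<mu> (A - B)\<bar>"
    \<comment> \<open>The set \<open>{B, A - B}\<close> collapses to a single element exactly when
      both blocks are empty.\<close>
    proof (cases "B = A - B")
      case True
      then have "B = {}" by auto
      then show ?thesis
        using True fin_additive_empty[OF bfa_add[OF assms(1)]] by auto
    qed simp
    then show "\<mu> B \<le> (tvar \<A> \<mu> A + \<mu> A) / 2"
      using le fin_additive_Diff[OF bfa_add[OF assms(1)] assms(2) B] by (simp add: field_simps)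
  qed
  then show "2 * upvar \<mu> A - \<mu> A \<le> tvar \<A> \<mu> A"
    by (simp add: field_simps)
qed

lemma abs_le_tvar: "bfa \<mu> \<Longrightarrow> A \<in> \<A> \<Longrightarrow> \<bar>\<mu> A\<bar> \<le> tvar \<A> \<mu> A"
  using part_sum_le_tvar[OF _ is_part_single, of \<mu> A] by simp

lemma tvar_nonneg:
  assumes "bfa \<mu>"
  shows "nonneg (tvar \<A> \<mu>)"
  unfolding nonneg_def
proof
  show "\<forall>B\<in>\<A>. 0 \<le> tvar \<A> \<mu> B"
    using abs_le_tvar[OF assms] by fastforce
  show "fin_additive \<A> (tvar \<A> \<mu>)"
    using fin_additiveD[OF bfa_add[OF assms]] fin_additiveD[OF nonneg_add[OF upvar_nonneg[OF assms]]]
    by (auto simp: fin_additive_def tvar_eq[OF assms] Un)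
qed

text \<open>The factor 3 counts one \<open>s\<close> for each term of
  \<open>2 * upvar \<mu> A - \<mu> A\<close>.\<close>

lemma tvar_le_of_abs_le:
  assumes "bfa \<mu>" "A \<in> \<A>" "\<And>B. B \<in> \<A> \<Longrightarrow> B \<subseteq> A \<Longrightarrow> \<bar>\<mu> B\<bar> \<le> s"
  shows "tvar \<A> \<mu> A \<le> 3 * s"
proof -
  have "upvar \<mu> A \<le> s"
    using assms(3) by (intro upvar_le) force
  then show ?thesis
    using assms(3)[of A] assms(2) by (simp add: tvar_eq[OF assms(1,2)])
qed

lemma tvar_of_nonneg:
  assumes "nonneg \<mu>" "A \<in> \<A>"
  shows "tvar \<A> \<mu> A = \<mu> A"
proof (rule antisym)
  show "tvar \<A> \<mu> A \<le> \<mu> A"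
  proof (rule tvar_le[OF assms(2)])
    fix P assume P: "is_part A P"
    have "(\<Sum>B\<in>P. \<bar>\<mu> B\<bar>) = (\<Sum>B\<in>P. \<mu> B)"
      using P nonneg_ge[OF assms(1)] by (intro sum.cong) (auto simp: is_part_def)
    then show "(\<Sum>B\<in>P. \<bar>\<mu> B\<bar>) \<le> \<mu> A"
      using fin_additive_part'[OF nonneg_add[OF assms(1)] P] by simp
  qed
  show "\<mu> A \<le> tvar \<A> \<mu> A"
    using abs_le_tvar[OF nonneg_bfa[OF assms(1)] assms(2)] by simp
qed

lemma tvar_cong:
  assumes "\<And>B. B \<in> \<A> \<Longrightarrow> \<mu> B = \<nu> B"
  shows "tvar \<A> \<mu> A = tvar \<A> \<nu> A"
  unfolding tvar_eq_SUP using assms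
  by (intro SUP_cong sum.cong) (auto simp: is_part_def intro!: arg_cong[where f = abs])

text \<open>Off the algebra \<open>tvar\<close> is the junk value \<open>Sup {}\<close>, so it has to be cut off to land in \<open>ba\<close>.\<close>

definition rst :: "('a set \<Rightarrow> real) \<Rightarrow> 'a set \<Rightarrow> real" where
  "rst f = (\<lambda>A. if A \<in> \<A> then f A else 0)"

lemma rst_in [simp]: "A \<in> \<A> \<Longrightarrow> rst f A = f A"
  by (simp add: rst_def)

lemma rst_ba: "bfa f \<Longrightarrow> rst f \<in> ba \<Omega> \<A>"
  by (auto simp: ba_def rst_def bfa_def fin_additive_def)

lemma tvar_rst [simp]: "tvar \<A> (rst f) A = tvar \<A> f A"
  by (rule tvar_cong) simp

lemma ba_norm_bound: "\<mu> \<in> ba \<Omega> \<A> \<Longrightarrow> A \<in> \<A> \<Longrightarrow> tvar \<A> \<mu> A \<le> ba_norm \<Omega> \<A> \<mu>"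
  unfolding ba_norm_def using nonneg_mono[OF tvar_nonneg[OF ba_bfa]] sets_into_space by auto

section \<open>Uniform strong additivity\<close>

definition usa :: "('a set \<Rightarrow> real) set \<Rightarrow> bool" where
  "usa M \<longleftrightarrow> (\<forall>D::nat \<Rightarrow> 'a set. range D \<subseteq> \<A> \<longrightarrow> disjoint_family D \<longrightarrow>
     (\<forall>\<epsilon>>0. \<exists>N. \<forall>n\<ge>N. \<forall>\<mu>\<in>M. tvar \<A> \<mu> (D n) < \<epsilon>))"

lemma usa_subset: "usa M \<Longrightarrow> M0 \<subseteq> M \<Longrightarrow> usa M0"
  unfolding usa_def by (meson subsetD)

text \<open>Large mass occurs at infinitely many indices; the corresponding subsequence of sets is
  still disjoint, and after relabelling measure and set share their index.\<close>

lemma not_usaE: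
  assumes "\<not> usa M"
  obtains D \<mu> \<epsilon> where "range D \<subseteq> \<A>" "disjoint_family (D :: nat \<Rightarrow> 'a set)" "0 < \<epsilon>"
    "\<And>n::nat. \<mu> n \<in> M" "\<And>n. \<epsilon> \<le> tvar \<A> (\<mu> n) (D n)"
proof -
  obtain D :: "nat \<Rightarrow> 'a set" and \<epsilon> where D: "range D \<subseteq> \<A>" "disjoint_family D" "0 < \<epsilon>"
    and ex: "\<And>N. \<exists>n\<ge>N. \<exists>\<mu>\<in>M. \<epsilon> \<le> tvar \<A> \<mu> (D n)"
    using assms unfolding usa_def by (auto simp: not_less)
  have "infinite {n. \<exists>\<mu>\<in>M. \<epsilon> \<le> tvar \<A> \<mu> (D n)}"
    using ex by (auto simp: infinite_nat_iff_unbounded_le)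
  then obtain r :: "nat \<Rightarrow> nat" where r: "strict_mono r" "\<And>n. \<exists>\<mu>\<in>M. \<epsilon> \<le> tvar \<A> \<mu> (D (r n))"
    using infinite_enumerate by blast
  then obtain \<mu> where \<mu>: "\<And>n. \<mu> n \<in> M" "\<And>n. \<epsilon> \<le> tvar \<A> (\<mu> n) (D (r n))"
    by metis
  have "disjoint_family (\<lambda>n. D (r n))"
    using D(2) strict_mono_eq[OF r(1)] by (auto simp: disjoint_family_on_def)
  moreover have "range (\<lambda>n. D (r n)) \<subseteq> \<A>"
    using D by auto
  ultimately show ?thesis
    using that D(3) \<mu> by blast
qed

text \<open>If the Cauchy condition failed, a gap of mass at least \<open>\<epsilon>\<close> could
  be found beyond any index. Letting each gap start no earlier than the previous one ends makes the
  differences disjoint.\<close>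

lemma usa_incseq_Cauchy:
  assumes usa: "usa M" and A: "range A \<subseteq> \<A>" "mono (A :: nat \<Rightarrow> 'a set)" and "0 < \<epsilon>"
  shows "\<exists>N. \<forall>m\<ge>N. \<forall>n\<ge>m. \<forall>\<mu>\<in>M. tvar \<A> \<mu> (A n - A m) < \<epsilon>"
proof (rule ccontr)
  assume "\<not> ?thesis"
  then have "\<forall>N. \<exists>p. N \<le> fst p \<and> fst p \<le> snd p \<and> (\<exists>\<mu>\<in>M. \<epsilon> \<le> tvar \<A> \<mu> (A (snd p) - A (fst p)))"
    by (fastforce simp: not_less)
  then obtain p where p: "\<And>N. N \<le> fst (p N)" "\<And>N. fst (p N) \<le> snd (p N)"
    "\<And>N. \<exists>\<mu>\<in>M. \<epsilon> \<le> tvar \<A> \<mu> (A (snd (p N)) - A (fst (p N)))"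
    by metis
  define N where "N = rec_nat 0 (\<lambda>_ k. snd (p k))"
  have N: "N (Suc i) = snd (p (N i))" for i
    by (simp add: N_def)
  have monoN: "N i \<le> N j" if "i \<le> j" for i j
    using p(1,2) by (intro lift_Suc_mono_le[OF _ that]) (auto simp: N intro: le_trans)
  define D where "D i = A (snd (p (N i))) - A (fst (p (N i)))" for i
  have "D i \<inter> D j = {}" if "i < j" for i j
  proof -
    have "snd (p (N i)) \<le> fst (p (N j))"
      using monoN[of "Suc i" j] that p(1)[of "N j"] by (simp add: N)
    then show ?thesis
      using monoD[OF A(2)] by (fastforce simp: D_def)
  qed
  then have "disjoint_family D"
    unfolding disjoint_family_on_def by (metis Int_commute nat_neq_iff)
  moreover have "range D \<subseteq> \<A>"
    using A by (auto simp: D_def)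
  ultimately have "\<exists>N. \<forall>n\<ge>N. \<forall>\<mu>\<in>M. tvar \<A> \<mu> (D n) < \<epsilon>"
    using usa \<open>0 < \<epsilon>\<close> unfolding usa_def by simp
  then obtain k where "\<And>\<mu>. \<mu> \<in> M \<Longrightarrow> tvar \<A> \<mu> (D k) < \<epsilon>"
    by blast
  then show False
    using p(3)[of "N k"] by (fastforce simp: D_def)
qed

lemma usa_decseq_Cauchy:
  assumes usa: "usa M" and A: "range A \<subseteq> \<A>" "antimono (A :: nat \<Rightarrow> 'a set)" and "0 < \<epsilon>"
  shows "\<exists>N. \<forall>m\<ge>N. \<forall>n\<ge>m. \<forall>\<mu>\<in>M. tvar \<A> \<mu> (A m - A n) < \<epsilon>"
proof -
  have "range (\<lambda>n. \<Omega> - A n) \<subseteq> \<A>"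
    using A by auto
  moreover have "mono (\<lambda>n. \<Omega> - A n)"
    using A(2) unfolding monotone_def by blast
  moreover have "(\<Omega> - A n) - (\<Omega> - A m) = A m - A n" for m n
    using A(1) sets_into_space by blast
  ultimately show ?thesis
    using usa_incseq_Cauchy[OF usa, of "\<lambda>n. \<Omega> - A n" \<epsilon>] \<open>0 < \<epsilon>\<close> by simp
qed

lemma tvar_Diff:
  assumes "\<mu> \<in> ba \<Omega> \<A>" "A \<in> \<A>" "B \<in> \<A>" "B \<subseteq> A"
  shows "tvar \<A> \<mu> (A - B) = tvar \<A> \<mu> A - tvar \<A> \<mu> B"
  using assms by (intro fin_additive_Diff nonneg_add tvar_nonneg ba_bfa)

lemma usa_imp_mono_cont:
  assumes usa: "usa M" and M: "M \<subseteq> ba \<Omega> \<A>" and A: "range A \<subseteq> \<A>" "mono (A :: nat \<Rightarrow> 'a set) \<or> antimono A"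
  shows "\<exists>L. \<forall>\<epsilon>>0. \<exists>N. \<forall>n\<ge>N. \<forall>\<mu>\<in>M. \<bar>tvar \<A> \<mu> (A n) - L \<mu>\<bar> < \<epsilon>"
proof -
  have A': "A n \<in> \<A>" for n
    using A by auto
  have "\<exists>N. \<forall>m\<ge>N. \<forall>n\<ge>m. \<forall>\<mu>\<in>M. \<bar>tvar \<A> \<mu> (A n) - tvar \<A> \<mu> (A m)\<bar> < \<epsilon>" if "0 < \<epsilon>" for \<epsilon>
    using A(2)
  proof
    assume m: "mono A"
    then have "\<bar>tvar \<A> \<mu> (A n) - tvar \<A> \<mu> (A m)\<bar> = tvar \<A> \<mu> (A n - A m)" if "\<mu> \<in> M" "m \<le> n" for \<mu> m n
      using tvar_Diff[OF subsetD[OF M that(1)] A' A'] monoD[OF m that(2)]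
        nonneg_ge[OF tvar_nonneg[OF ba_bfa[OF subsetD[OF M that(1)]]] Diff[OF A'[of n] A'[of m]]] by simp
    then show ?thesis
      using usa_incseq_Cauchy[OF usa A(1) m \<open>0 < \<epsilon>\<close>] by metis
  next
    assume m: "antimono A"
    then have "\<bar>tvar \<A> \<mu> (A n) - tvar \<A> \<mu> (A m)\<bar> = tvar \<A> \<mu> (A m - A n)" if "\<mu> \<in> M" "m \<le> n" for \<mu> m n
      using tvar_Diff[OF subsetD[OF M that(1)] A' A'] antimonoD[OF m that(2)]
        nonneg_ge[OF tvar_nonneg[OF ba_bfa[OF subsetD[OF M that(1)]]] Diff[OF A'[of m] A'[of n]]] by simp
    then show ?thesis
      using usa_decseq_Cauchy[OF usa A(1) m \<open>0 < \<epsilon>\<close>] by metis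
  qed
  then have "uniformly_Cauchy_on M (\<lambda>n \<mu>. tvar \<A> \<mu> (A n))"
    unfolding uniformly_Cauchy_on_def dist_real_def
    by (metis abs_minus_commute nle_le)
  then have "uniformly_convergent_on M (\<lambda>n \<mu>. tvar \<A> \<mu> (A n))"
    by (rule Cauchy_uniformly_convergent)
  then obtain L where "uniform_limit M (\<lambda>n \<mu>. tvar \<A> \<mu> (A n)) L sequentially"
    unfolding uniformly_convergent_on_def by blast
  then show ?thesis
    unfolding uniform_limit_sequentially_iff dist_real_def by blast
qed

text \<open>\<open>D n\<close> is the difference of two consecutive partial unions, whose masses are
  both within \<open>\<epsilon> / 2\<close> of the same limit.\<close>

lemma mono_cont_imp_usa:
  assumes M: "M \<subseteq> ba \<Omega> \<A>"
    and c3: "\<And>A::nat \<Rightarrow> 'a set. range A \<subseteq> \<A> \<Longrightarrow> mono A \<Longrightarrow>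
                (\<exists>L. \<forall>\<epsilon>>0. \<exists>N. \<forall>n\<ge>N. \<forall>\<mu>\<in>M. \<bar>tvar \<A> \<mu> (A n) - L \<mu>\<bar> < \<epsilon>)"
  shows "usa M"
  unfolding usa_def
proof (intro allI impI)
  fix D :: "nat \<Rightarrow> 'a set" and \<epsilon> :: real
  assume D: "range D \<subseteq> \<A>" "disjoint_family D" and "0 < \<epsilon>"
  define A where "A n = (\<Union>i<n. D i)" for n
  have A: "range A \<subseteq> \<A>" "mono A"
    using D(1) by (auto simp: A_def mono_def intro: less_le_trans)
  obtain L where "\<forall>\<epsilon>>0. \<exists>N. \<forall>n\<ge>N. \<forall>\<mu>\<in>M. \<bar>tvar \<A> \<mu> (A n) - L \<mu>\<bar> < \<epsilon>"
    using c3[OF A] by blast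
  then obtain N where N: "\<And>n \<mu>. N \<le> n \<Longrightarrow> \<mu> \<in> M \<Longrightarrow> \<bar>tvar \<A> \<mu> (A n) - L \<mu>\<bar> < \<epsilon> / 2"
    using \<open>0 < \<epsilon>\<close> by (meson half_gt_zero)
  have "tvar \<A> \<mu> (D n) < \<epsilon>" if "N \<le> n" "\<mu> \<in> M" for n \<mu>
  proof -
    have "D n \<inter> D i = {}" if "i < n" for i
      using disjoint_family_onD[OF D(2), of n i] that by auto
    then have "D n = A (Suc n) - A n"
      by (auto simp: A_def lessThan_Suc)
    then have "tvar \<A> \<mu> (D n) = tvar \<A> \<mu> (A (Suc n)) - tvar \<A> \<mu> (A n)"
      using A M that monoD[OF A(2), of n "Suc n"] tvar_Diff[of \<mu> "A (Suc n)" "A n"] by auto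
    then show ?thesis
      using N[of n \<mu>] N[of "Suc n" \<mu>] that by linarith
  qed
  then show "\<exists>N. \<forall>n\<ge>N. \<forall>\<mu>\<in>M. tvar \<A> \<mu> (D n) < \<epsilon>"
    by blast
qed

section \<open>Finite control of a uniformly strongly additive family\<close>

text \<open>If no finite set controls \<open>M\<close> up to \<open>\<epsilon>\<close>, there are \<open>\<mu>\<^sub>n\<close> and \<open>A\<^sub>n\<close>
with \<open>|\<mu>\<^sub>i|(A\<^sub>n) < 2\<^sup>-\<^sup>n\<close> for \<open>i < n\<close> and \<open>|\<mu>\<^sub>n|(A\<^sub>n) \<ge> \<epsilon>\<close>; truncating
the tails \<open>A\<^sub>n \<union> A\<^sub>n\<^sub>+\<^sub>1 \<union> \<dots>\<close> and intersecting gives a decreasing sequence that contradicts uniformity.\<close>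

lemma usa_finite_control:
  assumes usa: "usa M" and M: "M \<subseteq> ba \<Omega> \<A>" and "0 < \<epsilon>"
  shows "\<exists>F \<delta>. finite F \<and> F \<subseteq> M \<and> 0 < \<delta> \<and>
           (\<forall>A\<in>\<A>. (\<forall>\<nu>\<in>F. tvar \<A> \<nu> A < \<delta>) \<longrightarrow> (\<forall>\<mu>\<in>M. tvar \<A> \<mu> A < \<epsilon>))"
proof (rule ccontr)
  assume neg: "\<not> ?thesis"
  have step: "\<exists>p. fst p \<in> M \<and> snd p \<in> \<A> \<and> (\<forall>\<nu>\<in>set F. tvar \<A> \<nu> (snd p) < (1/2)^length F) \<and>
                  \<epsilon> \<le> tvar \<A> (fst p) (snd p)" if "set F \<subseteq> M" for F
    using neg[unfolded not_ex, rule_format, of "set F" "(1/2)^length F"] that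
    by (force simp: not_less)
  obtain g where g: "\<And>F. set F \<subseteq> M \<Longrightarrow> fst (g F) \<in> M \<and> snd (g F) \<in> \<A> \<and>
      (\<forall>\<nu>\<in>set F. tvar \<A> \<nu> (snd (g F)) < (1/2)^length F) \<and> \<epsilon> \<le> tvar \<A> (fst (g F)) (snd (g F))"
    using step by metis
  \<comment> \<open>The list of measures chosen so far, latest first; its length supplies the
    exponent in the smallness bound.\<close>
  define F where "F = rec_nat [] (\<lambda>_ xs. fst (g xs) # xs)"
  have F0: "F 0 = []" and FS: "F (Suc n) = fst (g (F n)) # F n" for n
    by (simp_all add: F_def)
  have FM: "set (F n) \<subseteq> M" and len: "length (F n) = n" for n
    using g by (induction n) (auto simp: F0 FS)
  define \<mu> where "\<mu> n = fst (g (F n))" for n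
  define A where "A n = snd (g (F n))" for n
  have F: "set (F n) = \<mu> ` {..<n}" for n
    by (induction n) (auto simp: F0 FS \<mu>_def lessThan_Suc)
  have \<mu>M: "\<mu> n \<in> M" and A: "A n \<in> \<A>" and big: "\<epsilon> \<le> tvar \<A> (\<mu> n) (A n)" for n
    using g[OF FM[of n]] by (auto simp: \<mu>_def A_def)
  have small: "tvar \<A> (\<mu> i) (A n) < (1/2)^n" if "i < n" for i n
    using g[OF FM[of n]] that by (auto simp: F len A_def)
  have nn: "nonneg (tvar \<A> \<nu>)" if "\<nu> \<in> M" for \<nu>
    using that M by (intro tvar_nonneg ba_bfa) auto
  \<comment> \<open>The whole tail union may lie outside \<open>\<A>\<close>. Cutting it at a stage
    \<open>N n\<close> that serves all of \<open>M\<close> loses less than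
    \<open>\<epsilon> / 4 * (1/2)^n\<close>, and these losses add up to at most
    \<open>\<epsilon> / 2\<close>.\<close>
  define U where "U n m = (\<Union>k\<in>{n..n+m}. A k)" for n m
  have U: "U n m \<in> \<A>" for n m
    using A by (auto simp: U_def)
  have "\<exists>N. \<forall>m\<ge>N. \<forall>\<nu>\<in>M. tvar \<A> \<nu> (U n m - U n N) < \<epsilon> / 4 * (1/2)^n" for n
  proof -
    have "mono (U n)"
      unfolding U_def mono_def by force
    then show ?thesis
      using usa_incseq_Cauchy[OF usa, of "U n" "\<epsilon> / 4 * (1/2)^n"] U \<open>0 < \<epsilon>\<close> by force
  qed
  then obtain N where N: "\<And>n m \<nu>. N n \<le> m \<Longrightarrow> \<nu> \<in> M \<Longrightarrow> tvar \<A> \<nu> (U n m - U n (N n)) < \<epsilon> / 4 * (1/2)^n"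
    by metis
  define C where "C n = U n (N n)" for n
  define D where "D n = (\<Inter>i\<in>{..n}. C i)" for n
  have CA: "C n \<in> \<A>" and DA: "D n \<in> \<A>" for n
    using U by (auto simp: C_def D_def)
  have C_diff: "tvar \<A> \<nu> (C n - C i) < \<epsilon> / 4 * (1/2)^i" if "\<nu> \<in> M" "i \<le> n" for \<nu> n i
  proof -
    let ?m = "max (N i) (n + N n)"
    have "C n \<subseteq> U i ?m"
      using that by (fastforce simp: C_def U_def)
    then have "tvar \<A> \<nu> (C n - C i) \<le> tvar \<A> \<nu> (U i ?m - U i (N i))"
      using U CA by (intro nonneg_mono nn that) (auto simp: C_def)
    then show ?thesis
      using N[of i ?m \<nu>] that by simp
  qed
  have D_big: "\<epsilon> / 2 \<le> tvar \<A> (\<mu> n) (D n)" for n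
  proof -
    have "tvar \<A> (\<mu> n) (\<Union>i\<in>{..n}. C n - C i) \<le> (\<Sum>i\<in>{..n}. tvar \<A> (\<mu> n) (C n - C i))"
      using CA by (intro nonneg_subadd_UN nn \<mu>M) auto
    also have "\<dots> \<le> (\<Sum>i\<in>{..n}. \<epsilon> / 4 * (1/2)^i)"
      using C_diff[OF \<mu>M] by (intro sum_mono) (simp add: less_imp_le)
    also have "\<dots> = \<epsilon> / 4 * (\<Sum>i<Suc n. (1/2)^i)"
      by (simp add: sum_distrib_left lessThan_Suc_atMost)
    also have "\<dots> \<le> \<epsilon> / 4 * 2"
      using \<open>0 < \<epsilon>\<close> by (intro mult_left_mono) (simp_all only: sum_gp_strict, auto simp: field_simps)
    finally have 1: "tvar \<A> (\<mu> n) (\<Union>i\<in>{..n}. C n - C i) \<le> \<epsilon> / 2"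
      by simp
    have "A n \<subseteq> D n \<union> (\<Union>i\<in>{..n}. C n - C i)"
      by (auto simp: D_def C_def U_def)
    then have "tvar \<A> (\<mu> n) (A n) \<le> tvar \<A> (\<mu> n) (D n \<union> (\<Union>i\<in>{..n}. C n - C i))"
      using A CA DA by (intro nonneg_mono nn \<mu>M Un finite_UN) auto
    also have "\<dots> \<le> tvar \<A> (\<mu> n) (D n) + tvar \<A> (\<mu> n) (\<Union>i\<in>{..n}. C n - C i)"
      using CA DA by (intro nonneg_subadd nn \<mu>M) auto
    finally show ?thesis
      using 1 big[of n] by linarith
  qed
  have "antimono D"
    unfolding D_def monotone_def by force
  \<comment> \<open>The uniform estimate past \<open>K\<close> is tested on \<open>\<mu> K\<close>
    itself: its mass on \<open>D K\<close> is at least \<open>\<epsilon> / 2\<close>, less than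
    \<open>\<epsilon> / 4\<close> is lost on the way to \<open>D n\<close>, yet less than
    \<open>\<epsilon> / 4\<close> is left there for large \<open>n\<close>.\<close>
  then obtain K where K: "\<And>n \<nu>. K \<le> n \<Longrightarrow> \<nu> \<in> M \<Longrightarrow> tvar \<A> \<nu> (D K - D n) < \<epsilon> / 4"
    using usa_decseq_Cauchy[OF usa, of D "\<epsilon> / 4"] DA \<open>0 < \<epsilon>\<close> by (meson image_subsetI divide_pos_pos zero_less_numeral order_refl)
  have D_small: "tvar \<A> (\<mu> K) (D n) \<le> 2 * (1/2)^n" if "K < n" for n
  proof -
    have "tvar \<A> (\<mu> K) (D n) \<le> tvar \<A> (\<mu> K) (C n)"
      using CA DA by (intro nonneg_mono nn \<mu>M) (auto simp: D_def)
    also have "\<dots> \<le> (\<Sum>k\<in>{n..n+N n}. tvar \<A> (\<mu> K) (A k))"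
      unfolding C_def U_def using A by (intro nonneg_subadd_UN nn \<mu>M) auto
    also have "\<dots> \<le> (\<Sum>k\<in>{n..n+N n}. (1/2)^k)"
      using small[of K] that by (intro sum_mono) (simp add: less_imp_le)
    also have "\<dots> \<le> 2 * (1/2)^n"
      by (subst sum_gp) (auto simp: field_simps)
    finally show ?thesis .
  qed
  have "(\<lambda>n. 2 * (1/2::real)^n) \<longlonglongrightarrow> 0"
    by (intro tendsto_mult_right_zero LIMSEQ_realpow_zero) auto
  then have "eventually (\<lambda>n. 2 * (1/2::real)^n < \<epsilon> / 4) sequentially"
    using \<open>0 < \<epsilon>\<close> by (intro order_tendstoD(2)[of _ 0]) auto
  then obtain n where n: "2 * (1/2::real)^n < \<epsilon> / 4" "K < n"
    using eventually_conj[OF _ eventually_gt_at_top[of K]] eventually_happens'[OF sequentially_bot] by blast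
  have "tvar \<A> (\<mu> K) (D K - D n) = tvar \<A> (\<mu> K) (D K) - tvar \<A> (\<mu> K) (D n)"
    using DA \<mu>M M antimonoD[OF \<open>antimono D\<close>, of K n] n by (intro tvar_Diff) auto
  then show False
    using K[of n "\<mu> K"] D_big[of K] D_small[of n] n \<mu>M by simp
qed

section \<open>Countable convex combinations and condition (i)\<close>

definition wsum :: "(nat \<Rightarrow> real) \<Rightarrow> (nat \<Rightarrow> 'a set \<Rightarrow> real) \<Rightarrow> 'a set \<Rightarrow> real" where
  "wsum \<alpha> \<mu> A = (\<Sum>n. \<alpha> n * (tvar \<A> (\<mu> n) A / max 1 (ba_norm \<Omega> \<A> (\<mu> n))))"

context
  fixes \<alpha> :: "nat \<Rightarrow> real" and \<mu> :: "nat \<Rightarrow> 'a set \<Rightarrow> real"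
  assumes \<alpha>: "\<And>n. 0 \<le> \<alpha> n" "summable \<alpha>" and \<mu>: "\<And>n. \<mu> n \<in> ba \<Omega> \<A>"
begin

lemma wsum_term_nonneg:
  "A \<in> \<A> \<Longrightarrow> 0 \<le> \<alpha> n * (tvar \<A> (\<mu> n) A / max 1 (ba_norm \<Omega> \<A> (\<mu> n)))"
  using \<alpha>(1) nonneg_ge[OF tvar_nonneg[OF ba_bfa[OF \<mu>]]]
  by (intro mult_nonneg_nonneg divide_nonneg_nonneg) auto

lemma wsum_summable:
  assumes "A \<in> \<A>"
  shows "summable (\<lambda>n. \<alpha> n * (tvar \<A> (\<mu> n) A / max 1 (ba_norm \<Omega> \<A> (\<mu> n))))"
proof (rule summable_comparison_test'[OF \<alpha>(2)])
  fix n
  have "tvar \<A> (\<mu> n) A / max 1 (ba_norm \<Omega> \<A> (\<mu> n)) \<le> 1"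
    using ba_norm_bound[OF \<mu> assms, of n] by (simp add: field_simps)
  then have "\<alpha> n * (tvar \<A> (\<mu> n) A / max 1 (ba_norm \<Omega> \<A> (\<mu> n))) \<le> \<alpha> n * 1"
    using \<alpha> by (intro mult_left_mono) auto
  then show "norm (\<alpha> n * (tvar \<A> (\<mu> n) A / max 1 (ba_norm \<Omega> \<A> (\<mu> n)))) \<le> \<alpha> n"
    using wsum_term_nonneg[OF assms, of n] by simp
qed

lemma wsum_nonneg: "nonneg (wsum \<alpha> \<mu>)"
  unfolding nonneg_def fin_additive_def wsum_def
proof (intro conjI ballI impI)
  fix A B assume AB: "A \<in> \<A>" "B \<in> \<A>" "A \<inter> B = {}"
  show "(\<Sum>n. \<alpha> n * (tvar \<A> (\<mu> n) (A \<union> B) / max 1 (ba_norm \<Omega> \<A> (\<mu> n)))) =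
      (\<Sum>n. \<alpha> n * (tvar \<A> (\<mu> n) A / max 1 (ba_norm \<Omega> \<A> (\<mu> n)))) +
      (\<Sum>n. \<alpha> n * (tvar \<A> (\<mu> n) B / max 1 (ba_norm \<Omega> \<A> (\<mu> n))))"
    unfolding suminf_add[OF wsum_summable[OF AB(1)] wsum_summable[OF AB(2)]]
    using fin_additiveD[OF nonneg_add[OF tvar_nonneg[OF ba_bfa[OF \<mu>]]] AB]
    by (simp add: add_divide_distrib distrib_left)
next
  fix B assume "B \<in> \<A>"
  then show "0 \<le> (\<Sum>n. \<alpha> n * (tvar \<A> (\<mu> n) B / max 1 (ba_norm \<Omega> \<A> (\<mu> n))))"
    using wsum_term_nonneg wsum_summable by (intro suminf_nonneg) auto
qed

lemma wsum_ge_term: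
  assumes "A \<in> \<A>"
  shows "\<alpha> n * (tvar \<A> (\<mu> n) A / max 1 (ba_norm \<Omega> \<A> (\<mu> n))) \<le> wsum \<alpha> \<mu> A"
  using sum_le_suminf[OF wsum_summable[OF assms], of "{n}"] wsum_term_nonneg[OF assms]
  by (simp add: wsum_def)

lemma wsum_dominates:
  assumes "0 < \<alpha> n" "0 < \<epsilon>"
  shows "\<exists>\<delta>>0. \<forall>A\<in>\<A>. wsum \<alpha> \<mu> A < \<delta> \<longrightarrow> tvar \<A> (\<mu> n) A < \<epsilon>"
proof (intro exI conjI ballI impI)
  let ?k = "max 1 (ba_norm \<Omega> \<A> (\<mu> n))"
  show "0 < \<alpha> n * (\<epsilon> / ?k)"
    using assms by simp
  fix A assume "A \<in> \<A>" "wsum \<alpha> \<mu> A < \<alpha> n * (\<epsilon> / ?k)"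
  then have "\<alpha> n * (tvar \<A> (\<mu> n) A / ?k) < \<alpha> n * (\<epsilon> / ?k)"
    using wsum_ge_term[of A n] by simp
  then show "tvar \<A> (\<mu> n) A < \<epsilon>"
    using assms by (simp add: divide_less_cancel)
qed

end

lemma convA_eq: "convA \<Omega> \<A> M = {wsum \<alpha> \<mu> | \<alpha> \<mu>. (\<forall>n. \<mu> n \<in> M) \<and> (\<forall>n. \<alpha> n \<ge> 0) \<and> \<alpha> sums 1}"
  unfolding convA_def wsum_def[abs_def] ..

lemma convA_nonneg:
  assumes "M \<subseteq> ba \<Omega> \<A>" "m \<in> convA \<Omega> \<A> M"
  shows "nonneg m"
proof -
  obtain \<alpha> \<mu> where "m = wsum \<alpha> \<mu>" "\<And>n. \<mu> n \<in> M" "\<And>n. \<alpha> n \<ge> 0" "\<alpha> sums 1"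
    using assms(2) unfolding convA_eq by blast
  then show ?thesis
    using assms(1) by (auto intro!: wsum_nonneg sums_summable)
qed

text \<open>The values of a nonnegative charge along a disjoint sequence are summable, so
  \<open>m (D n)\<close> eventually falls below any \<open>\<delta>\<close>.\<close>

lemma usa_if_abs_cont:
  assumes m: "nonneg m"
    and ac: "\<And>\<epsilon>. 0 < \<epsilon> \<Longrightarrow> \<exists>\<delta>>0. \<forall>A\<in>\<A>. m A < \<delta> \<longrightarrow> (\<forall>\<mu>\<in>M. tvar \<A> \<mu> A < \<epsilon>)"
  shows "usa M"
  unfolding usa_def
proof (intro allI impI)
  fix D :: "nat \<Rightarrow> 'a set" and \<epsilon> :: real
  assume D: "range D \<subseteq> \<A>" "disjoint_family D" "0 < \<epsilon>"
  obtain \<delta> where \<delta>: "0 < \<delta>" "\<forall>A\<in>\<A>. m A < \<delta> \<longrightarrow> (\<forall>\<mu>\<in>M. tvar \<A> \<mu> A < \<epsilon>)"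
    using ac[OF D(3)] by blast
  have "eventually (\<lambda>n. m (D n) < \<delta>) sequentially"
    using \<delta> nonneg_disjoint_tendsto[OF m D(1,2)] by (intro order_tendstoD(2)[of _ 0]) auto
  then obtain N where "\<And>n. N \<le> n \<Longrightarrow> m (D n) < \<delta>"
    by (auto simp: eventually_sequentially)
  then show "\<exists>N. \<forall>n\<ge>N. \<forall>\<mu>\<in>M. tvar \<A> \<mu> (D n) < \<epsilon>"
    using \<delta>(2) D(1) by (meson range_subsetD)
qed

text \<open>The finite control sets for the tolerances 1/(k+1) have a countable union. Enumerating
  it with strictly positive weights gives an \<open>m\<close> that dominates every controlling
  measure.\<close>

lemma usa_imp_convA:
  assumes usa: "usa M" and M: "M \<subseteq> ba \<Omega> \<A>" "M \<noteq> {}"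
  shows "\<exists>m\<in>convA \<Omega> \<A> M. \<forall>\<epsilon>>0. \<exists>\<delta>>0. \<forall>A\<in>\<A>. m A < \<delta> \<longrightarrow> (\<forall>\<mu>\<in>M. tvar \<A> \<mu> A < \<epsilon>)"
proof -
  have "\<forall>k. \<exists>F \<delta>. finite F \<and> F \<subseteq> M \<and> 0 < \<delta> \<and>
      (\<forall>A\<in>\<A>. (\<forall>\<nu>\<in>F. tvar \<A> \<nu> A < \<delta>) \<longrightarrow> (\<forall>\<mu>\<in>M. tvar \<A> \<mu> A < inverse (real (Suc k))))"
    using usa_finite_control[OF usa M(1)] by simp
  then obtain F \<delta> where F: "\<And>k. finite (F k)" "\<And>k. F k \<subseteq> M" and \<delta>: "\<And>k. 0 < \<delta> k" and
      ctrl: "\<And>k A \<mu>. A \<in> \<A> \<Longrightarrow> (\<forall>\<nu>\<in>F k. tvar \<A> \<nu> A < \<delta> k) \<Longrightarrow> \<mu> \<in> M \<Longrightarrow>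
              tvar \<A> \<mu> A < inverse (real (Suc k))"
    by metis
  obtain \<mu>0 where \<mu>0: "\<mu>0 \<in> M"
    using M by auto
  \<comment> \<open>\<open>\<mu>0\<close> keeps \<open>S\<close> nonempty, and hence enumerable by
    \<open>from_nat_into\<close>, even if all control sets are empty.\<close>
  define S where "S = insert \<mu>0 (\<Union>k. F k)"
  have S: "countable S" "S \<noteq> {}" "S \<subseteq> M"
    using F \<mu>0 by (auto simp: S_def countable_finite)
  define \<mu> where "\<mu> = from_nat_into S"
  have rng: "range \<mu> = S"
    using S by (simp add: \<mu>_def range_from_nat_into)
  then have \<mu>: "\<mu> n \<in> M" "\<mu> n \<in> ba \<Omega> \<A>" for n
    using S M by auto
  define \<alpha> :: "nat \<Rightarrow> real" where "\<alpha> n = (1/2)^Suc n" for n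
  have \<alpha>: "\<alpha> sums 1" "\<And>n. 0 \<le> \<alpha> n" "\<And>n. 0 < \<alpha> n" "summable \<alpha>"
    using power_half_series by (auto simp: \<alpha>_def[abs_def] sums_iff)
  have "\<exists>d>0. \<forall>A\<in>\<A>. wsum \<alpha> \<mu> A < d \<longrightarrow> (\<forall>\<nu>\<in>M. tvar \<A> \<nu> A < \<epsilon>)" if \<epsilon>: "0 < \<epsilon>" for \<epsilon>
  proof -
    obtain k where k: "inverse (real (Suc k)) < \<epsilon>"
      using reals_Archimedean[OF \<epsilon>] by auto
    have "\<exists>d>0. \<forall>A\<in>\<A>. wsum \<alpha> \<mu> A < d \<longrightarrow> tvar \<A> \<nu> A < \<delta> k" if "\<nu> \<in> F k" for \<nu>
    proof -
      have "\<nu> \<in> range \<mu>"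
        using that by (auto simp: rng S_def)
      then show ?thesis
        using wsum_dominates[OF \<alpha>(2,4) \<mu>(2) \<alpha>(3) \<delta>] by auto
    qed
    then obtain d where d: "\<And>\<nu>. \<nu> \<in> F k \<Longrightarrow> 0 < d \<nu>"
      "\<And>\<nu> A. \<nu> \<in> F k \<Longrightarrow> A \<in> \<A> \<Longrightarrow> wsum \<alpha> \<mu> A < d \<nu> \<Longrightarrow> tvar \<A> \<nu> A < \<delta> k"
      by metis
    \<comment> \<open>The \<open>1\<close> provides a positive minimum when \<open>F k\<close> is
      empty.\<close>
    let ?d = "Min (insert 1 (d ` F k))"
    have "0 < ?d"
      using F d by (simp add: Min_gr_iff)
    moreover have "tvar \<A> \<nu> A < \<epsilon>" if "A \<in> \<A>" "wsum \<alpha> \<mu> A < ?d" "\<nu> \<in> M" for A \<nu>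
    proof -
      have "\<forall>\<nu>\<in>F k. tvar \<A> \<nu> A < \<delta> k"
        using that F d by (auto simp: Min_gr_iff)
      then show ?thesis
        using ctrl[OF that(1) _ that(3)] k by fastforce
    qed
    ultimately show ?thesis
      by blast
  qed
  moreover have "wsum \<alpha> \<mu> \<in> convA \<Omega> \<A> M"
    unfolding convA_eq using \<mu> \<alpha> by blast
  ultimately show ?thesis
    by blast
qed

section \<open>Uniform absolute continuity, uniform convergence, and uniform orthogonality from
  strong additivity\<close>

text \<open>Only the finitely many controlling measures matter, and for these the least of their
  individual thresholds is uniform.\<close>

lemma usa_imp_uac:
  assumes usa: "usa M" and M: "M \<subseteq> ba \<Omega> \<A>" and ac: "\<And>\<mu>. \<mu> \<in> M \<Longrightarrow> abs_cont \<A> \<mu> lam" and "0 < \<epsilon>"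
  shows "\<exists>\<delta>>0. \<forall>A\<in>\<A>. tvar \<A> lam A < \<delta> \<longrightarrow> (\<forall>\<mu>\<in>M. tvar \<A> \<mu> A < \<epsilon>)"
proof -
  obtain F \<delta> where F: "finite F" "F \<subseteq> M" "0 < \<delta>"
    and ctrl: "\<And>A. A \<in> \<A> \<Longrightarrow> \<forall>\<nu>\<in>F. tvar \<A> \<nu> A < \<delta> \<Longrightarrow> \<forall>\<mu>\<in>M. tvar \<A> \<mu> A < \<epsilon>"
    using usa_finite_control[OF usa M \<open>0 < \<epsilon>\<close>] by blast
  have "\<forall>\<nu>\<in>F. \<exists>d>0. \<forall>A\<in>\<A>. tvar \<A> lam A < d \<longrightarrow> tvar \<A> \<nu> A < \<delta>"
    using F ac unfolding abs_cont_def by blast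
  then obtain d where d: "\<And>\<nu>. \<nu> \<in> F \<Longrightarrow> 0 < d \<nu>"
    "\<And>\<nu> A. \<nu> \<in> F \<Longrightarrow> A \<in> \<A> \<Longrightarrow> tvar \<A> lam A < d \<nu> \<Longrightarrow> tvar \<A> \<nu> A < \<delta>"
    by metis
  let ?d = "Min (insert 1 (d ` F))"
  have "0 < ?d"
    using F d by (simp add: Min_gr_iff)
  moreover have "\<forall>\<mu>\<in>M. tvar \<A> \<mu> A < \<epsilon>" if "A \<in> \<A>" "tvar \<A> lam A < ?d" for A
    using that F d by (intro ctrl) (auto simp: Min_gr_iff)
  ultimately show ?thesis
    by blast
qed

text \<open>The witnesses of a failure are countably many, so one weighted series dominates them
  whatever the size of \<open>M\<close>. Condition (v), applied to these witnesses alone, makes them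
  uniformly continuous with respect to the series and hence strongly additive.\<close>

lemma uac_imp_usa:
  assumes M: "M \<subseteq> ba \<Omega> \<A>"
    and c5: "\<And>M0 lam \<epsilon>. M0 \<subseteq> M \<Longrightarrow> lam \<in> ba \<Omega> \<A> \<Longrightarrow> (\<And>\<mu>. \<mu> \<in> M0 \<Longrightarrow> abs_cont \<A> \<mu> lam) \<Longrightarrow> 0 < \<epsilon> \<Longrightarrow>
      \<exists>\<delta>>0. \<forall>A\<in>\<A>. tvar \<A> lam A < \<delta> \<longrightarrow> (\<forall>\<mu>\<in>M0. tvar \<A> \<mu> A < \<epsilon>)"
  shows "usa M"
proof (rule ccontr)
  assume "\<not> usa M"
  then obtain D \<mu> \<epsilon> where D: "range D \<subseteq> \<A>" "disjoint_family (D :: nat \<Rightarrow> 'a set)" "0 < \<epsilon>"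
    and \<mu>: "\<And>n::nat. \<mu> n \<in> M" and big: "\<And>n. \<epsilon> \<le> tvar \<A> (\<mu> n) (D n)"
    by (rule not_usaE) blast
  have \<mu>ba: "\<mu> n \<in> ba \<Omega> \<A>" for n
    using \<mu> M by auto
  define \<alpha> :: "nat \<Rightarrow> real" where "\<alpha> n = (1/2)^Suc n" for n
  have \<alpha>: "\<And>n. 0 \<le> \<alpha> n" "\<And>n. 0 < \<alpha> n" "summable \<alpha>"
    using power_half_series by (auto simp: \<alpha>_def[abs_def] sums_iff)
  have nn: "nonneg (wsum \<alpha> \<mu>)"
    using \<alpha> \<mu>ba by (intro wsum_nonneg)
  let ?lam = "rst (wsum \<alpha> \<mu>)"
  have lam: "?lam \<in> ba \<Omega> \<A>" "\<And>A. A \<in> \<A> \<Longrightarrow> tvar \<A> ?lam A = wsum \<alpha> \<mu> A"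
    using nn by (auto intro!: rst_ba nonneg_bfa simp: tvar_of_nonneg)
  have "abs_cont \<A> \<nu> ?lam" if "\<nu> \<in> range \<mu>" for \<nu>
    using that wsum_dominates[OF \<alpha>(1,3) \<mu>ba \<alpha>(2)] lam(2) by (auto simp: abs_cont_def)
  then have "usa (range \<mu>)"
    using c5[of "range \<mu>" ?lam] \<mu> lam by (intro usa_if_abs_cont[OF nn]) auto
  then have "\<exists>N. \<forall>n\<ge>N. \<forall>\<nu>\<in>range \<mu>. tvar \<A> \<nu> (D n) < \<epsilon>"
    using D unfolding usa_def by simp
  then show False
    using big by (meson le_refl not_less rangeI)
qed

text \<open>The unions increase with \<open>k\<close>, so \<open>L j\<close> bounds the variation on
  \<open>A j\<close>; thus each measure tends to 0 along \<open>A\<close>, and uniformity needs this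
  only for the finite control set.\<close>

lemma usa_imp_unif_tendsto:
  assumes usa: "usa M" and M: "M \<subseteq> ba \<Omega> \<A>" and A: "range A \<subseteq> \<A>"
    and lim: "\<And>\<mu>. \<mu> \<in> M \<Longrightarrow> \<exists>L::nat \<Rightarrow> real.
                   (\<forall>j. (\<lambda>k. tvar \<A> \<mu> (\<Union>n\<in>{j..j+k}. A n)) \<longlonglongrightarrow> L j) \<and> L \<longlonglongrightarrow> 0"
    and "0 < \<epsilon>"
  shows "\<exists>N. \<forall>n\<ge>N. \<forall>\<mu>\<in>M. \<bar>\<mu> (A n)\<bar> < \<epsilon>"
proof -
  have AA: "A n \<in> \<A>" for n
    using A by auto
  have nn: "nonneg (tvar \<A> \<mu>)" if "\<mu> \<in> M" for \<mu>
    using that M by (intro tvar_nonneg ba_bfa) auto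
  obtain F \<delta> where F: "finite F" "F \<subseteq> M" "0 < \<delta>"
    and ctrl: "\<And>A. A \<in> \<A> \<Longrightarrow> \<forall>\<nu>\<in>F. tvar \<A> \<nu> A < \<delta> \<Longrightarrow> \<forall>\<mu>\<in>M. tvar \<A> \<mu> A < \<epsilon>"
    using usa_finite_control[OF usa M \<open>0 < \<epsilon>\<close>] by blast
  have "eventually (\<lambda>n. tvar \<A> \<nu> (A n) < \<delta>) sequentially" if \<nu>: "\<nu> \<in> M" for \<nu>
  proof -
    obtain L where L: "\<And>j. (\<lambda>k. tvar \<A> \<nu> (\<Union>n\<in>{j..j+k}. A n)) \<longlonglongrightarrow> L j" "L \<longlonglongrightarrow> 0"
      using lim[OF \<nu>] by blast
    have "tvar \<A> \<nu> (A j) \<le> L j" for j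
    proof (rule LIMSEQ_le_const[OF L(1)], intro exI allI impI)
      show "tvar \<A> \<nu> (A j) \<le> tvar \<A> \<nu> (\<Union>n\<in>{j..j+k}. A n)" for k
        using AA by (intro nonneg_mono nn \<nu> finite_UN UN_upper) auto
    qed
    moreover have "eventually (\<lambda>j. L j < \<delta>) sequentially"
      using L(2) F(3) by (rule order_tendstoD)
    ultimately show ?thesis
      by (auto elim!: eventually_mono intro: le_less_trans)
  qed
  then have "eventually (\<lambda>n. \<forall>\<nu>\<in>F. tvar \<A> \<nu> (A n) < \<delta>) sequentially"
    using F by (intro eventually_ball_finite) auto
  then have "eventually (\<lambda>n. \<forall>\<mu>\<in>M. \<bar>\<mu> (A n)\<bar> < \<epsilon>) sequentially"
  proof eventually_elim
    case (elim n)
    then show ?case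
      using ctrl[OF AA elim] abs_le_tvar[OF ba_bfa AA] M by (metis le_less_trans subsetD)
  qed
  then show ?thesis
    by (simp add: eventually_sequentially)
qed

lemma abs_gt_of_tvar:
  assumes "bfa \<mu>" "A \<in> \<A>" "3 * s < tvar \<A> \<mu> A"
  shows "\<exists>B\<in>\<A>. B \<subseteq> A \<and> s < \<bar>\<mu> B\<bar>"
proof (rule ccontr)
  assume "\<not> ?thesis"
  then have "tvar \<A> \<mu> A \<le> 3 * s"
    using assms by (intro tvar_le_of_abs_le) (auto simp: not_less)
  then show False
    using assms by simp
qed

text \<open>Condition (iv) and the sliding hump see \<mu>(A) and not its variation, so each set is
  shrunk to one on which \<mu> itself is large. The new threshold is a quarter of the old because
  3/4 is strictly below 1.\<close>

lemma not_usaE':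
  assumes "\<not> usa M" "M \<subseteq> ba \<Omega> \<A>"
  obtains D \<mu> \<epsilon> where "range D \<subseteq> \<A>" "disjoint_family (D :: nat \<Rightarrow> 'a set)" "0 < \<epsilon>"
    "\<And>n::nat. \<mu> n \<in> M" "\<And>n. \<epsilon> < \<bar>\<mu> n (D n)\<bar>"
proof -
  obtain D \<mu> \<epsilon> where D: "range D \<subseteq> \<A>" "disjoint_family (D :: nat \<Rightarrow> 'a set)" "0 < \<epsilon>"
    and \<mu>: "\<And>n::nat. \<mu> n \<in> M" and big: "\<And>n. \<epsilon> \<le> tvar \<A> (\<mu> n) (D n)"
    by (rule not_usaE[OF assms(1)]) blast
  have "\<exists>B\<in>\<A>. B \<subseteq> D n \<and> \<epsilon> / 4 < \<bar>\<mu> n B\<bar>" for n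
    using \<mu> assms(2) big[of n] D by (intro abs_gt_of_tvar ba_bfa) auto
  then obtain B where B: "\<And>n. B n \<in> \<A>" "\<And>n. B n \<subseteq> D n" "\<And>n. \<epsilon> / 4 < \<bar>\<mu> n (B n)\<bar>"
    by metis
  have "disjoint_family B"
    using D(2) B(2) unfolding disjoint_family_on_def by blast
  then show ?thesis
    using that[of B "\<epsilon> / 4" \<mu>] B D(3) \<mu> by auto
qed

text \<open>A disjoint sequence always satisfies the premise of (iv): the masses of its tail unions
  are tails of a convergent series. The conclusion then contradicts the large values on the
  diagonal.\<close>

lemma unif_tendsto_imp_usa:
  assumes M: "M \<subseteq> ba \<Omega> \<A>"
    and c4: "\<And>A \<epsilon>. range A \<subseteq> \<A> \<Longrightarrow> (\<And>\<mu>. \<mu> \<in> M \<Longrightarrow> \<exists>L::nat \<Rightarrow> real.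
                   (\<forall>j. (\<lambda>k. tvar \<A> \<mu> (\<Union>n\<in>{j..j+k}. A n)) \<longlonglongrightarrow> L j) \<and> L \<longlonglongrightarrow> 0) \<Longrightarrow>
             0 < \<epsilon> \<Longrightarrow> \<exists>N. \<forall>n\<ge>N. \<forall>\<mu>\<in>M. \<bar>\<mu> (A n)\<bar> < \<epsilon>"
  shows "usa M"
proof (rule ccontr)
  assume "\<not> usa M"
  then obtain D \<mu> \<epsilon> where D: "range D \<subseteq> \<A>" "disjoint_family (D :: nat \<Rightarrow> 'a set)" "0 < \<epsilon>"
    and \<mu>: "\<And>n::nat. \<mu> n \<in> M" and big: "\<And>n. \<epsilon> < \<bar>\<mu> n (D n)\<bar>"
    by (rule not_usaE'[OF _ M]) blast
  have "\<exists>L::nat \<Rightarrow> real. (\<forall>j. (\<lambda>k. tvar \<A> \<nu> (\<Union>n\<in>{j..j+k}. D n)) \<longlonglongrightarrow> L j) \<and> L \<longlonglongrightarrow> 0"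
    if "\<nu> \<in> M" for \<nu>
  proof (intro exI conjI allI)
    have nn: "nonneg (tvar \<A> \<nu>)"
      using that M by (intro tvar_nonneg ba_bfa) auto
    let ?f = "\<lambda>n. tvar \<A> \<nu> (D n)"
    have sm: "summable ?f"
      by (rule nonneg_disjoint_summable[OF nn D(1,2)])
    show "(\<lambda>k. tvar \<A> \<nu> (\<Union>n\<in>{j..j+k}. D n)) \<longlonglongrightarrow> (\<Sum>n. ?f (n + j))" for j
    proof -
      have "tvar \<A> \<nu> (\<Union>n\<in>{j..j+k}. D n) = (\<Sum>n<Suc k. ?f (n + j))" for k
      proof -
        have "tvar \<A> \<nu> (\<Union>n\<in>{j..j+k}. D n) = (\<Sum>n\<in>{j..j+k}. ?f n)"
          using D by (intro fin_additive_UN nonneg_add nn) (auto simp: disjoint_family_on_def)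
        also have "\<dots> = (\<Sum>n<Suc k. ?f (n + j))"
          using sum.shift_bounds_cl_nat_ivl[of ?f 0 j k]
          by (simp add: add.commute lessThan_Suc_atMost atMost_atLeast0)
        finally show ?thesis .
      qed
      then show ?thesis
        \<comment> \<open>\<open>LIMSEQ_Suc\<close> is needed because \<open>{j..j+k}\<close> has
          \<open>k + 1\<close> elements.\<close>
        using LIMSEQ_Suc[OF summable_LIMSEQ[OF summable_ignore_initial_segment[OF sm, of j]]] by simp
    qed
    show "(\<lambda>j. \<Sum>n. ?f (n + j)) \<longlonglongrightarrow> 0"
      using suminf_exist_split2[OF sm] by (simp add: add.commute)
  qed
  then have "\<exists>N. \<forall>n\<ge>N. \<forall>\<nu>\<in>M. \<bar>\<nu> (D n)\<bar> < \<epsilon>"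
    by (intro c4 D)
  then obtain N where "\<forall>n\<ge>N. \<forall>\<nu>\<in>M. \<bar>\<nu> (D n)\<bar> < \<epsilon>" ..
  then show False
    using big[of N] \<mu>[of N] by force
qed

text \<open>Off the union of the sets \<open>B \<nu>\<close> every controlling \<open>\<nu>\<close>
  is small, hence all of \<open>M\<close> is; on the union \<open>lam\<close> is small because only
  finitely many sets are joined.\<close>

lemma usa_imp_unif_orth:
  assumes usa: "usa M" and M: "M \<subseteq> ba \<Omega> \<A>" and lam: "lam \<in> ba \<Omega> \<A>"
    and orth: "\<And>\<mu>. \<mu> \<in> M \<Longrightarrow> orth \<Omega> \<A> lam \<mu>" and "0 < \<epsilon>"
  shows "\<exists>A\<in>\<A>. \<exists>s\<ge>0. (\<forall>\<mu>\<in>M. tvar \<A> \<mu> A \<le> s) \<and> s + tvar \<A> lam (\<Omega> - A) < \<epsilon>"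
proof -
  obtain F \<delta> where F: "finite F" "F \<subseteq> M" "0 < \<delta>"
    and ctrl: "\<And>A. A \<in> \<A> \<Longrightarrow> \<forall>\<nu>\<in>F. tvar \<A> \<nu> A < \<delta> \<Longrightarrow> \<forall>\<mu>\<in>M. tvar \<A> \<mu> A < \<epsilon> / 2"
    using usa_finite_control[OF usa M half_gt_zero[OF \<open>0 < \<epsilon>\<close>]] by blast
  \<comment> \<open>The bound by \<open>\<delta>\<close> triggers the control; the other bound keeps
    the union at \<open>lam\<close>-mass at most \<open>\<epsilon> / 4\<close>, and its
    \<open>+ 1\<close> covers an empty \<open>F\<close>.\<close>
  define \<eta> where "\<eta> = min \<delta> (\<epsilon> / (4 * real (card F + 1)))"
  have \<eta>: "0 < \<eta>"
    using F \<open>0 < \<epsilon>\<close> by (simp add: \<eta>_def)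
  have "\<forall>\<nu>\<in>F. \<exists>B\<in>\<A>. tvar \<A> lam B + tvar \<A> \<nu> (\<Omega> - B) < \<eta>"
    using orth F(2) \<eta> unfolding orth_def by blast
  then obtain B where B: "\<And>\<nu>. \<nu> \<in> F \<Longrightarrow> B \<nu> \<in> \<A>"
    "\<And>\<nu>. \<nu> \<in> F \<Longrightarrow> tvar \<A> lam (B \<nu>) + tvar \<A> \<nu> (\<Omega> - B \<nu>) < \<eta>"
    by metis
  have nn: "nonneg (tvar \<A> lam)" "\<And>\<nu>. \<nu> \<in> M \<Longrightarrow> nonneg (tvar \<A> \<nu>)"
    using M lam by (auto intro!: tvar_nonneg ba_bfa)
  let ?U = "\<Union>\<nu>\<in>F. B \<nu>"
  have U: "?U \<in> \<A>"
    using F B by auto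
  have 1: "tvar \<A> lam (B \<nu>) \<le> \<eta>" "tvar \<A> \<nu> (\<Omega> - B \<nu>) < \<delta>" if "\<nu> \<in> F" for \<nu>
  proof -
    have "0 \<le> tvar \<A> lam (B \<nu>)" "0 \<le> tvar \<A> \<nu> (\<Omega> - B \<nu>)"
      using that B F nn by (auto intro!: nonneg_ge)
    then show "tvar \<A> lam (B \<nu>) \<le> \<eta>" "tvar \<A> \<nu> (\<Omega> - B \<nu>) < \<delta>"
      using B(2)[OF that] by (auto simp: \<eta>_def)
  qed
  have "tvar \<A> \<nu> (\<Omega> - ?U) < \<delta>" if "\<nu> \<in> F" for \<nu>
  proof -
    have "tvar \<A> \<nu> (\<Omega> - ?U) \<le> tvar \<A> \<nu> (\<Omega> - B \<nu>)"
      using that B F U by (intro nonneg_mono nn) auto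
    then show ?thesis
      using 1(2)[OF that] by simp
  qed
  then have 2: "\<forall>\<mu>\<in>M. tvar \<A> \<mu> (\<Omega> - ?U) < \<epsilon> / 2"
    using U by (intro ctrl) auto
  have "tvar \<A> lam ?U \<le> (\<Sum>\<nu>\<in>F. tvar \<A> lam (B \<nu>))"
    using F B by (intro nonneg_subadd_UN nn) auto
  also have "\<dots> \<le> (\<Sum>\<nu>\<in>F. \<eta>)"
    using 1 by (intro sum_mono)
  also have "\<dots> \<le> real (card F + 1) * \<eta>"
    using \<eta> by simp
  also have "\<dots> \<le> real (card F + 1) * (\<epsilon> / (4 * real (card F + 1)))"
    by (intro mult_left_mono) (auto simp: \<eta>_def)
  also have "\<dots> = \<epsilon> / 4"
    by (simp add: field_simps)
  finally have 3: "tvar \<A> lam ?U \<le> \<epsilon> / 4" .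
  have "\<Omega> - (\<Omega> - ?U) = ?U"
    using U sets_into_space by blast
  then show ?thesis
    using 2 3 U \<open>0 < \<epsilon>\<close> by (intro bexI[of _ "\<Omega> - ?U"] exI[of _ "\<epsilon> / 2"]) (auto simp: less_imp_le)
qed

end

section \<open>Uniform orthogonality\<close>

text \<open>Tychonoff's theorem; for functions of sets the product topology is setwise
  convergence.\<close>

lemma compact_function_box: "compact {g :: 'b \<Rightarrow> real. \<forall>x. g x \<in> {a..b}}"
proof -
  have "compactin (product_topology (\<lambda>_. euclidean) UNIV) (PiE UNIV (\<lambda>_::'b. {a..b}))"
    by (simp add: compactin_PiE)
  moreover have "PiE UNIV (\<lambda>_::'b. {a..b}) = {g. \<forall>x. g x \<in> {a..b}}"
    by (auto simp: PiE_def)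
  ultimately show ?thesis
    by (simp add: euclidean_product_topology)
qed

text \<open>The closed sets that eventually contain the sequence have the finite intersection
  property inside \<open>K\<close>. Any closed condition that holds eventually thus passes to
  \<open>g\<close>, without a convergent subsequence.\<close>

lemma compactin_cluster_point:
  assumes K: "compactin X K" and f: "\<And>n. f n \<in> K"
  obtains g where "g \<in> K" "\<And>S. closedin X S \<Longrightarrow> eventually (\<lambda>n::nat. f n \<in> S) sequentially \<Longrightarrow> g \<in> S"
proof -
  let ?U = "{S. closedin X S \<and> eventually (\<lambda>n. f n \<in> S) sequentially}"
  have "K \<inter> \<Inter>\<F> \<noteq> {}" if "finite \<F>" "\<F> \<subseteq> ?U" for \<F>
  proof -
    have "eventually (\<lambda>n. \<forall>S\<in>\<F>. f n \<in> S) sequentially"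
      using that by (intro eventually_ball_finite) auto
    then obtain n where "\<forall>S\<in>\<F>. f n \<in> S"
      by (auto simp: eventually_sequentially)
    then show ?thesis
      using f[of n] by auto
  qed
  then have "K \<inter> \<Inter>?U \<noteq> {}"
    using K unfolding compactin_fip by (metis (no_types, lifting) mem_Collect_eq)
  then show ?thesis
    using that by blast
qed

lemma compact_cluster_point:
  assumes "compact K" "\<And>n. f n \<in> K"
  obtains g where "g \<in> K" "\<And>S. closed S \<Longrightarrow> eventually (\<lambda>n::nat. f n \<in> S) sequentially \<Longrightarrow> g \<in> S"
  using compactin_cluster_point[of euclidean K f] assms by auto

lemma closed_Collect_eval:
  fixes c :: real
  shows "closed {g :: 'b \<Rightarrow> real. g x = c}" "closed {g :: 'b \<Rightarrow> real. \<bar>g x\<bar> \<le> c}"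
    "closed {g :: 'b \<Rightarrow> real. g x = g y + g z}"
  by (intro closed_Collect_eq closed_Collect_le continuous_intros continuous_on_product_coordinates)+

context set_alg
begin

text \<open>Each block of a partition is cut by the sets \<open>D n\<close> and bounded, by
  countable additivity, by the sum over its pieces. After exchanging the sums, the pieces inside a
  fixed \<open>D n\<close> account for at most its variation.\<close>

lemma tvar_ca_le:
  assumes \<mu>: "\<mu> \<in> ca \<Omega> \<A>" and D: "range D \<subseteq> \<A>" "disjoint_family (D :: nat \<Rightarrow> 'a set)" "(\<Union>n. D n) \<in> \<A>"
  shows "tvar \<A> \<mu> (\<Union>n. D n) \<le> (\<Sum>n. tvar \<A> \<mu> (D n))"
proof (rule tvar_le[OF D(3)])
  have bfa: "bfa \<mu>"
    using \<mu> by (auto simp: ca_def ba_iff)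
  have nn: "nonneg (tvar \<A> \<mu>)"
    by (rule tvar_nonneg[OF bfa])
  have sm: "summable (\<lambda>n. tvar \<A> \<mu> (D n))"
    by (rule nonneg_disjoint_summable[OF nn D(1,2)])
  have DA: "D n \<in> \<A>" for n
    using D by auto
  fix P assume P: "is_part (\<Union>n. D n) P"
  have PA: "E \<in> \<A>" if "E \<in> P" for E
    using P that by (auto simp: is_part_def)
  have absle: "\<bar>\<mu> (D n \<inter> E)\<bar> \<le> tvar \<A> \<mu> (D n \<inter> E)" if "E \<in> P" for n E
    using abs_le_tvar[OF bfa] DA PA that by blast
  have absle': "\<bar>\<mu> (D n \<inter> E)\<bar> \<le> tvar \<A> \<mu> (D n)" if "E \<in> P" for n E
  proof -
    have "tvar \<A> \<mu> (D n \<inter> E) \<le> tvar \<A> \<mu> (D n)"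
      using DA PA that by (intro nonneg_mono nn) auto
    then show ?thesis
      using absle[OF that, of n] by simp
  qed
  have sm': "summable (\<lambda>n. \<bar>\<mu> (D n \<inter> E)\<bar>)" if "E \<in> P" for E
    using absle'[OF that] by (intro summable_comparison_test'[OF sm]) auto
  have "\<bar>\<mu> E\<bar> \<le> (\<Sum>n. \<bar>\<mu> (D n \<inter> E)\<bar>)" if E: "E \<in> P" for E
  proof -
    have *: "(\<Union>n. D n \<inter> E) = E"
      using P E by (auto simp: is_part_def)
    moreover have "range (\<lambda>n. D n \<inter> E) \<subseteq> \<A>" "disjoint_family (\<lambda>n. D n \<inter> E)"
      using DA PA[OF E] D(2) by (auto simp: disjoint_family_on_def)
    ultimately have "(\<lambda>n. \<mu> (D n \<inter> E)) sums \<mu> E"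
      using \<mu>[unfolded ca_def, simplified, THEN conjunct2, rule_format, of "\<lambda>n. D n \<inter> E"] PA[OF E]
      by simp
    then have "\<mu> E = (\<Sum>n. \<mu> (D n \<inter> E))"
      by (simp add: sums_iff)
    then show ?thesis
      using summable_rabs[OF sm'[OF E]] by simp
  qed
  then have "(\<Sum>E\<in>P. \<bar>\<mu> E\<bar>) \<le> (\<Sum>E\<in>P. \<Sum>n. \<bar>\<mu> (D n \<inter> E)\<bar>)"
    by (intro sum_mono)
  also have "\<dots> = (\<Sum>n. \<Sum>E\<in>P. \<bar>\<mu> (D n \<inter> E)\<bar>)"
    using sm' by (intro suminf_sum[symmetric])
  also have "\<dots> \<le> (\<Sum>n. tvar \<A> \<mu> (D n))"
  proof (rule suminf_le)
    fix n
    have "(\<Sum>E\<in>P. \<bar>\<mu> (D n \<inter> E)\<bar>) \<le> (\<Sum>E\<in>P. tvar \<A> \<mu> (D n \<inter> E))"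
      using absle by (intro sum_mono)
    also have "\<dots> = tvar \<A> \<mu> (D n)"
      using DA by (intro fin_additive_part[OF nonneg_add[OF nn] P]) auto
    finally show "(\<Sum>E\<in>P. \<bar>\<mu> (D n \<inter> E)\<bar>) \<le> tvar \<A> \<mu> (D n)" .
  qed (use sm sm' in \<open>auto intro: summable_sum\<close>)
  finally show "(\<Sum>E\<in>P. \<bar>\<mu> E\<bar>) \<le> (\<Sum>n. tvar \<A> \<mu> (D n))" .
qed

text \<open>The tail unions are bounded by the tails of the convergent series of variations.\<close>

lemma ca_tail_tendsto:
  assumes \<mu>: "\<mu> \<in> ca \<Omega> \<A>" and D: "range D \<subseteq> \<A>" "disjoint_family (D :: nat \<Rightarrow> 'a set)"
    and B: "\<And>j. (\<Union>n. D (n + j)) \<in> \<A>"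
  shows "(\<lambda>j. tvar \<A> \<mu> (\<Union>n. D (n + j))) \<longlonglongrightarrow> 0"
proof (rule tendsto_sandwich[OF _ _ tendsto_const])
  have nn: "nonneg (tvar \<A> \<mu>)"
    using \<mu> by (intro tvar_nonneg) (auto simp: ca_def ba_iff)
  have sm: "summable (\<lambda>n. tvar \<A> \<mu> (D n))"
    by (rule nonneg_disjoint_summable[OF nn D])
  show "(\<lambda>j. \<Sum>n. tvar \<A> \<mu> (D (n + j))) \<longlonglongrightarrow> 0"
    using suminf_exist_split2[OF sm] by simp
  show "eventually (\<lambda>j. 0 \<le> tvar \<A> \<mu> (\<Union>n. D (n + j))) sequentially"
    using B nonneg_ge[OF nn] by simp
  have "disjoint_family (\<lambda>n. D (n + j))" for j
    using D(2) by (auto simp: disjoint_family_on_def)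
  then show "eventually (\<lambda>j. tvar \<A> \<mu> (\<Union>n. D (n + j)) \<le> (\<Sum>n. tvar \<A> \<mu> (D (n + j)))) sequentially"
    using B D by (intro always_eventually allI tvar_ca_le[OF \<mu>]) auto
qed

text \<open>If \<open>|\<mu>\<^sub>n|(D\<^sub>n) \<ge> \<epsilon>\<close> with \<open>D\<^sub>n\<close> disjoint, a setwise cluster point \<open>\<lambda>\<close> of the normalised restrictions of
\<open>|\<mu>\<^sub>n|\<close> to \<open>D\<^sub>n\<close> lives on every tail \<open>D\<^sub>j \<union> D\<^sub>j\<^sub>+\<^sub>1 \<union> \<dots>\<close>. It is therefore orthogonal to each countably
additive \<open>\<mu>\<^sub>n\<close>, but not uniformly so.\<close>

lemma unif_orth_imp_usa:
  assumes M: "M \<subseteq> ca \<Omega> \<A>" and sigma: "sigma_algebra \<Omega> \<A>"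
    and c6: "\<And>M0 lam \<epsilon>. M0 \<subseteq> M \<Longrightarrow> lam \<in> ba \<Omega> \<A> \<Longrightarrow> (\<And>\<mu>. \<mu> \<in> M0 \<Longrightarrow> orth \<Omega> \<A> lam \<mu>) \<Longrightarrow> 0 < \<epsilon> \<Longrightarrow>
      \<exists>A\<in>\<A>. \<exists>s\<ge>0. (\<forall>\<mu>\<in>M0. tvar \<A> \<mu> A \<le> s) \<and> s + tvar \<A> lam (\<Omega> - A) < \<epsilon>"
  shows "usa M"
proof (rule ccontr)
  assume "\<not> usa M"
  then obtain D \<mu> \<epsilon> where D: "range D \<subseteq> \<A>" "disjoint_family (D :: nat \<Rightarrow> 'a set)" "0 < \<epsilon>"
    and \<mu>: "\<And>n::nat. \<mu> n \<in> M" and big: "\<And>n. \<epsilon> \<le> tvar \<A> (\<mu> n) (D n)"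
    by (rule not_usaE) blast
  have \<mu>ca: "\<mu> n \<in> ca \<Omega> \<A>" for n
    using \<mu> M by auto
  then have nn: "nonneg (tvar \<A> (\<mu> n))" for n
    by (intro tvar_nonneg) (auto simp: ca_def ba_iff)
  have DA: "D n \<in> \<A>" for n
    using D by auto
  have pos: "0 < tvar \<A> (\<mu> n) (D n)" for n
    using big[of n] D(3) by simp
  \<comment> \<open>These are full tails, not truncated ones; the sigma-algebra is used to keep them
    in \<open>\<A>\<close>.\<close>
  define B where "B j = (\<Union>n. D (n + j))" for j
  have B: "B j \<in> \<A>" for j
    unfolding B_def using DA by (intro sigma_algebra.countable_nat_UN[OF sigma]) auto
  have DB: "D n \<subseteq> B j" if "j \<le> n" for j n
    unfolding B_def using that by (intro UN_upper[of "n - j", THEN subset_trans[rotated]]) auto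
  define l where "l n = rst (\<lambda>A. tvar \<A> (\<mu> n) (A \<inter> D n) / tvar \<A> (\<mu> n) (D n))" for n
  have l_box: "l n A \<in> {0..1}" for n A
  proof (cases "A \<in> \<A>")
    case True
    then have "tvar \<A> (\<mu> n) (A \<inter> D n) \<le> tvar \<A> (\<mu> n) (D n)" "0 \<le> tvar \<A> (\<mu> n) (A \<inter> D n)"
      using DA by (auto intro!: nonneg_mono[OF nn] nonneg_ge[OF nn])
    then show ?thesis
      using True pos[of n] by (simp add: l_def)
  qed (simp add: l_def rst_def)
  have l_one: "l n A = 1" if "A \<in> \<A>" "D n \<subseteq> A" for n A
    using that pos[of n] by (simp add: l_def Int_absorb1)
  have l_add: "l n (A \<union> A') = l n A + l n A'" if "A \<in> \<A>" "A' \<in> \<A>" "A \<inter> A' = {}" for n A A'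
  proof -
    have "tvar \<A> (\<mu> n) ((A \<inter> D n) \<union> (A' \<inter> D n)) = tvar \<A> (\<mu> n) (A \<inter> D n) + tvar \<A> (\<mu> n) (A' \<inter> D n)"
      using that DA by (intro fin_additiveD nonneg_add nn) auto
    then show ?thesis
      using that by (simp add: l_def Int_Un_distrib2 add_divide_distrib Un)
  qed
  have "l n \<in> {g. \<forall>x. g x \<in> {0..1}}" for n
    using l_box by auto
  then obtain lam where lam_box: "lam \<in> {g. \<forall>x. g x \<in> {0..1}}"
    and clu: "\<And>S. closed S \<Longrightarrow> eventually (\<lambda>n. l n \<in> S) sequentially \<Longrightarrow> lam \<in> S"
    by (rule compact_cluster_point[OF compact_function_box, where f = l]) blast
  have lam_off: "lam A = 0" if "A \<notin> \<A>" for A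
    using clu[OF closed_Collect_eval(1)[of A 0]] that by (auto simp: l_def rst_def)
  have lam_add: "lam (A \<union> A') = lam A + lam A'" if "A \<in> \<A>" "A' \<in> \<A>" "A \<inter> A' = {}" for A A'
    using clu[OF closed_Collect_eval(3)[of "A \<union> A'" A A']] l_add that by auto
  have lam_nn: "nonneg lam"
    using lam_box lam_add by (auto simp: nonneg_def fin_additive_def)
  then have lam_ba: "lam \<in> ba \<Omega> \<A>"
    using lam_off by (auto simp: ba_iff intro: nonneg_bfa)
  have lam_B: "lam (B j) = 1" for j
    using clu[OF closed_Collect_eval(1)[of "B j" 1]] l_one[OF B DB]
    by (auto simp: eventually_sequentially)
  have lam_\<Omega>: "lam \<Omega> = 1"
    using clu[OF closed_Collect_eval(1)[of "\<Omega>" 1]] l_one[OF top sets_into_space[OF DA]]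
    by (auto simp: eventually_sequentially)
  have "orth \<Omega> \<A> lam (\<mu> i)" for i
    unfolding orth_def
  proof (intro allI impI)
    fix e :: real assume "0 < e"
    have "(\<lambda>j. tvar \<A> (\<mu> i) (B j)) \<longlonglongrightarrow> 0"
      unfolding B_def using B by (intro ca_tail_tendsto[OF \<mu>ca D(1,2)]) (simp add: B_def)
    then have "eventually (\<lambda>j. tvar \<A> (\<mu> i) (B j) < e) sequentially"
      using \<open>0 < e\<close> by (rule order_tendstoD)
    then obtain j where j: "tvar \<A> (\<mu> i) (B j) < e"
      by (auto simp: eventually_sequentially)
    have "\<Omega> - (\<Omega> - B j) = B j" and sub: "B j \<subseteq> \<Omega>"
      using sets_into_space[OF B[of j]] by auto
    moreover have "tvar \<A> lam (\<Omega> - B j) = 0"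
      using tvar_of_nonneg[OF lam_nn, of "\<Omega> - B j"] B lam_B lam_\<Omega>
        fin_additive_Diff[OF nonneg_add[OF lam_nn] top B sub] by auto
    ultimately show "\<exists>A\<in>\<A>. tvar \<A> lam A + tvar \<A> (\<mu> i) (\<Omega> - A) < e"
      using j B by (intro bexI[of _ "\<Omega> - B j"]) auto
  qed
  \<comment> \<open>The bound \<open>1/2\<close> forces \<open>lam A > 1/2\<close>, since
    \<open>lam \<Omega> = 1\<close>; the bound \<open>\<epsilon> / 2\<close> gives
    \<open>s / \<epsilon> < 1/2\<close>, and \<open>lam A\<close> cannot exceed
    \<open>s / \<epsilon>\<close> because no \<open>l n A\<close> does.\<close>
  then have "\<exists>A\<in>\<A>. \<exists>s\<ge>0. (\<forall>\<nu>\<in>range \<mu>. tvar \<A> \<nu> A \<le> s) \<and> s + tvar \<A> lam (\<Omega> - A) < min (1/2) (\<epsilon> / 2)"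
    using \<mu> lam_ba D(3) by (intro c6) auto
  then obtain A s where A: "A \<in> \<A>" "0 \<le> s" "\<And>n. tvar \<A> (\<mu> n) A \<le> s"
    and s: "s + tvar \<A> lam (\<Omega> - A) < min (1/2) (\<epsilon> / 2)"
    by auto
  have "l n A \<le> s / \<epsilon>" for n
  proof -
    have "tvar \<A> (\<mu> n) (A \<inter> D n) \<le> tvar \<A> (\<mu> n) A"
      using A DA by (intro nonneg_mono nn) auto
    then have "tvar \<A> (\<mu> n) (A \<inter> D n) / tvar \<A> (\<mu> n) (D n) \<le> s / \<epsilon>"
      using A(2) A(3)[of n] big[of n] D(3) by (intro frac_le) auto
    then show ?thesis
      using A by (simp add: l_def)
  qed
  then have "\<bar>l n A\<bar> \<le> s / \<epsilon>" for n
    using l_box[of n A] by simp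
  then have "\<bar>lam A\<bar> \<le> s / \<epsilon>"
    using clu[OF closed_Collect_eval(2)[of A "s / \<epsilon>"]] by auto
  moreover have "tvar \<A> lam (\<Omega> - A) = 1 - lam A"
    using tvar_of_nonneg[OF lam_nn, of "\<Omega> - A"] A lam_\<Omega>
      fin_additive_Diff[OF nonneg_add[OF lam_nn] top A(1) sets_into_space[OF A(1)]] by auto
  moreover have "s / \<epsilon> < 1/2" if "s < \<epsilon> / 2"
    using that D(3) by (simp add: field_simps)
  moreover have "0 \<le> tvar \<A> lam (\<Omega> - A)"
    using A lam_nn by (intro nonneg_ge[OF tvar_nonneg[OF nonneg_bfa]]) auto
  ultimately show False
    using s A(2) by linarith
qed

end

section \<open>Weak compactness implies uniform strong additivity\<close>

text \<open>Both smallness conditions hold for all large \<open>k'\<close>: the first because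
  finitely many columns tend to 0, the second because row \<open>k\<close> is summable and
  \<open>r k'\<close> grows.\<close>

lemma sliding_hump_step:
  fixes z :: "nat \<Rightarrow> nat \<Rightarrow> real"
  assumes summ: "\<And>k. summable (\<lambda>j. \<bar>z k j\<bar>)" and lim: "\<And>j. (\<lambda>k. z k j) \<longlonglongrightarrow> 0"
    and r: "strict_mono (r :: nat \<Rightarrow> nat)" and c: "0 < c"
  shows "\<exists>k'>k. (\<Sum>j\<le>r k. \<bar>z k' j\<bar>) < c \<and> (\<Sum>n. \<bar>z k (n + r k')\<bar>) < c"
proof -
  have "(\<lambda>k'. \<Sum>j\<le>r k. \<bar>z k' j\<bar>) \<longlonglongrightarrow> (\<Sum>j\<le>r k. \<bar>0\<bar>)"
    by (intro tendsto_sum tendsto_rabs lim)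
  then have "eventually (\<lambda>k'. (\<Sum>j\<le>r k. \<bar>z k' j\<bar>) < c) sequentially"
    using c by (intro order_tendstoD(2)[of _ 0]) auto
  moreover have "(\<lambda>m. \<Sum>n. \<bar>z k (n + m)\<bar>) \<longlonglongrightarrow> 0"
    using suminf_exist_split2[OF summ] by simp
  then have "(\<lambda>k'. \<Sum>n. \<bar>z k (n + r k')\<bar>) \<longlonglongrightarrow> 0"
    using filterlim_compose filterlim_subseq[OF r] by blast
  then have "eventually (\<lambda>k'. (\<Sum>n. \<bar>z k (n + r k')\<bar>) < c) sequentially"
    using c by (rule order_tendstoD)
  ultimately have "eventually (\<lambda>k'. (\<Sum>j\<le>r k. \<bar>z k' j\<bar>) < c \<and> (\<Sum>n. \<bar>z k (n + r k')\<bar>) < c \<and> k < k') sequentially"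
    using eventually_gt_at_top[of k] by eventually_elim auto
  then show ?thesis
    by (auto simp: eventually_sequentially)
qed

text \<open>In the selected row \<open>i\<close> the entry at column \<open>r (\<kappa> i)\<close>
  is at least \<open>c\<close>, while the selected columns before it and those after it contribute
  at most \<open>c / 4\<close> each; so half of the hump survives in the sum.\<close>

lemma sliding_hump:
  fixes z :: "nat \<Rightarrow> nat \<Rightarrow> real"
  assumes summ: "\<And>k. summable (\<lambda>j. \<bar>z k j\<bar>)" and lim: "\<And>j. (\<lambda>k. z k j) \<longlonglongrightarrow> 0"
    and r: "strict_mono (r :: nat \<Rightarrow> nat)" and c: "0 < c"
    and big: "eventually (\<lambda>k. c \<le> \<bar>z k (r k)\<bar>) sequentially"
  obtains \<kappa> where "strict_mono (\<kappa> :: nat \<Rightarrow> nat)" "\<And>i. c / 2 \<le> \<bar>\<Sum>l. z (\<kappa> i) (r (\<kappa> l))\<bar>"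
proof -
  obtain k0 where k0: "\<And>k. k0 \<le> k \<Longrightarrow> c \<le> \<bar>z k (r k)\<bar>"
    using big by (auto simp: eventually_sequentially)
  \<comment> \<open>One transition secures both sides: the next row is small up to the current hump
    column, and the current row is small from the next hump column on.\<close>
  have "\<exists>\<kappa>. \<forall>i. k0 \<le> \<kappa> i \<and> (\<kappa> i < \<kappa> (Suc i) \<and> (\<Sum>j\<le>r (\<kappa> i). \<bar>z (\<kappa> (Suc i)) j\<bar>) < c / 4 \<and>
          (\<Sum>n. \<bar>z (\<kappa> i) (n + r (\<kappa> (Suc i)))\<bar>) < c / 4)"
  proof (rule dependent_nat_choice)
    fix k and i :: nat assume "k0 \<le> k"
    moreover obtain k' where "k < k'" "(\<Sum>j\<le>r k. \<bar>z k' j\<bar>) < c / 4" "(\<Sum>n. \<bar>z k (n + r k')\<bar>) < c / 4"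
      using sliding_hump_step[OF summ lim r, of "c / 4" k] c by auto
    ultimately show "\<exists>k'. k0 \<le> k' \<and> (k < k' \<and> (\<Sum>j\<le>r k. \<bar>z k' j\<bar>) < c / 4 \<and> (\<Sum>n. \<bar>z k (n + r k')\<bar>) < c / 4)"
      by (intro exI[of _ k']) simp
  qed auto
  then obtain \<kappa> where \<kappa>: "\<And>i. k0 \<le> \<kappa> i" "\<And>i. \<kappa> i < \<kappa> (Suc i)"
    and left: "\<And>i. (\<Sum>j\<le>r (\<kappa> i). \<bar>z (\<kappa> (Suc i)) j\<bar>) < c / 4"
    and right: "\<And>i. (\<Sum>n. \<bar>z (\<kappa> i) (n + r (\<kappa> (Suc i)))\<bar>) < c / 4"
    by blast
  have mono: "strict_mono \<kappa>"
    using \<kappa>(2) by (simp add: strict_mono_Suc_iff)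
  define J where "J l = r (\<kappa> l)" for l
  have J: "strict_mono J"
    using mono r by (auto simp: J_def strict_mono_def)
  have "c / 2 \<le> \<bar>\<Sum>l. z (\<kappa> i) (J l)\<bar>" for i
  proof -
    let ?w = "\<lambda>l. z (\<kappa> i) (J l)"
    have sw: "summable (\<lambda>l. \<bar>?w l\<bar>)"
      using summable_reindex[OF summ[of "\<kappa> i"], of J] strict_mono_imp_inj_on[OF J] by (simp add: o_def)
    have sw': "summable ?w"
      by (rule summable_rabs_cancel[OF sw])
    have "\<bar>\<Sum>l<i. ?w l\<bar> \<le> c / 4"
    proof (cases i)
      case (Suc p)
      have "\<bar>\<Sum>l<i. ?w l\<bar> \<le> (\<Sum>l<i. \<bar>?w l\<bar>)"
        by (rule sum_abs)
      also have "\<dots> = (\<Sum>j\<in>J ` {..<i}. \<bar>z (\<kappa> i) j\<bar>)"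
        by (subst sum.reindex) (auto intro: strict_mono_imp_inj_on[OF J] inj_on_subset)
      also have "\<dots> \<le> (\<Sum>j\<le>r (\<kappa> p). \<bar>z (\<kappa> i) j\<bar>)"
        using strict_mono_less_eq[OF J] by (intro sum_mono2) (auto simp: Suc J_def less_Suc_eq_le)
      also have "\<dots> < c / 4"
        using left[of p] by (simp add: Suc)
      finally show ?thesis by simp
    qed (use c in simp)
    moreover have "\<bar>\<Sum>n. ?w (n + Suc i)\<bar> \<le> c / 4"
    proof -
      \<comment> \<open>Measuring the selected columns from \<open>J (Suc i)\<close> exhibits them
        as an injective selection from the tail of row \<open>\<kappa> i\<close>, so their sum is at
        most the full tail.\<close>
      let ?g = "\<lambda>n. J (n + Suc i) - J (Suc i)"
      have ge: "J (Suc i) \<le> J (n + Suc i)" for n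
        using strict_mono_less_eq[OF J] by simp
      have inj: "inj ?g"
        using ge strict_mono_eq[OF J] by (intro injI) (metis add_right_cancel eq_diff_iff)
      have s1: "summable (\<lambda>n. \<bar>z (\<kappa> i) (n + J (Suc i))\<bar>)"
        by (rule summable_ignore_initial_segment[OF summ])
      have s2: "summable (\<lambda>n. \<bar>?w (n + Suc i)\<bar>)"
        by (rule summable_ignore_initial_segment[OF sw])
      have "\<bar>\<Sum>n. ?w (n + Suc i)\<bar> \<le> (\<Sum>n. \<bar>?w (n + Suc i)\<bar>)"
        by (rule summable_rabs[OF s2])
      also have "\<dots> = suminf ((\<lambda>n. \<bar>z (\<kappa> i) (n + J (Suc i))\<bar>) \<circ> ?g)"
        using ge by (simp add: o_def)
      also have "\<dots> \<le> (\<Sum>n. \<bar>z (\<kappa> i) (n + J (Suc i))\<bar>)"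
        by (rule suminf_reindex_mono[OF s1 inj]) simp
      finally show ?thesis
        using right[of i] by (simp add: J_def)
    qed
    moreover have "(\<Sum>l. ?w l) = (\<Sum>n. ?w (n + Suc i)) + (\<Sum>l<i. ?w l) + ?w i"
      using suminf_split_initial_segment[OF sw', of "Suc i"] by simp
    moreover have "c \<le> \<bar>?w i\<bar>"
      using k0[OF \<kappa>(1)] by (simp add: J_def)
    ultimately show ?thesis
      by linarith
  qed
  then show ?thesis
    using that[OF mono] by (simp add: J_def)
qed

context set_alg
begin

lemma zero_in_dual: "(\<lambda>_. 0) \<in> ba_dual \<Omega> \<A>"
  by (auto simp: ba_dual_def intro: exI[of _ 0])

lemma topspace_ba_weak [simp]: "topspace (ba_weak \<Omega> \<A>) = ba \<Omega> \<A>"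
proof -
  have "{\<mu> \<in> ba \<Omega> \<A>. (0::real) \<in> UNIV} \<in> {{\<mu> \<in> ba \<Omega> \<A>. \<phi> \<mu> \<in> U} | \<phi> U. \<phi> \<in> ba_dual \<Omega> \<A> \<and> open U}"
    using zero_in_dual by blast
  then show ?thesis
    unfolding ba_weak_def topology_generated_by_topspace by auto
qed

lemma closedin_ba_weak:
  assumes "\<phi> \<in> ba_dual \<Omega> \<A>" "closed S"
  shows "closedin (ba_weak \<Omega> \<A>) {\<mu> \<in> ba \<Omega> \<A>. \<phi> \<mu> \<in> S}"
proof -
  have "openin (ba_weak \<Omega> \<A>) {\<mu> \<in> ba \<Omega> \<A>. \<phi> \<mu> \<in> - S}"
    unfolding ba_weak_def using assms by (intro topology_generated_by_Basis) blast
  moreover have "ba \<Omega> \<A> - {\<mu> \<in> ba \<Omega> \<A>. \<phi> \<mu> \<in> S} = {\<mu> \<in> ba \<Omega> \<A>. \<phi> \<mu> \<in> - S}"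
    by auto
  ultimately show ?thesis
    by (auto simp: closedin_def)
qed

lemma eval_in_dual:
  assumes "A \<in> \<A>"
  shows "(\<lambda>\<mu>. \<mu> A) \<in> ba_dual \<Omega> \<A>"
proof -
  have "\<bar>\<mu> A\<bar> \<le> 1 * ba_norm \<Omega> \<A> \<mu>" if "\<mu> \<in> ba \<Omega> \<A>" for \<mu>
    using ba_norm_bound[OF that assms] abs_le_tvar[OF ba_bfa[OF that] assms] by simp
  then show ?thesis
    unfolding ba_dual_def by blast
qed

lemma disjoint_abs_summable:
  assumes "bfa \<mu>" "range D \<subseteq> \<A>" "disjoint_family (D :: nat \<Rightarrow> 'a set)"
  shows "summable (\<lambda>n. \<bar>\<mu> (D n)\<bar>)"
  using assms abs_le_tvar[OF assms(1)]
  by (intro summable_comparison_test'[OF nonneg_disjoint_summable[OF tvar_nonneg]]) auto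

lemma disjoint_sum_abs_le:
  assumes "bfa \<mu>" "range D \<subseteq> \<A>" "disjoint_family (D :: nat \<Rightarrow> 'a set)"
  shows "(\<Sum>i<n. \<bar>\<mu> (D i)\<bar>) \<le> tvar \<A> \<mu> \<Omega>"
proof -
  have "(\<Sum>i<n. \<bar>\<mu> (D i)\<bar>) \<le> (\<Sum>i<n. tvar \<A> \<mu> (D i))"
    using assms by (intro sum_mono abs_le_tvar) auto
  also have "\<dots> = tvar \<A> \<mu> (\<Union>i<n. D i)"
    using assms by (intro fin_additive_UN[symmetric] nonneg_add tvar_nonneg) (auto simp: disjoint_family_on_def)
  also have "\<dots> \<le> tvar \<A> \<mu> \<Omega>"
    using assms sets_into_space by (intro nonneg_mono tvar_nonneg) blast+
  finally show ?thesis .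
qed

text \<open>The masses on disjoint sets sum absolutely to at most the norm, and summation is bounded
  on l^1. Taken over a subsequence of the sets, this is the functional that detects the
  humps.\<close>

lemma disjoint_sum_in_dual:
  assumes D: "range D \<subseteq> \<A>" "disjoint_family (D :: nat \<Rightarrow> 'a set)"
  shows "(\<lambda>\<mu>. \<Sum>n. \<mu> (D n)) \<in> ba_dual \<Omega> \<A>"
proof -
  have sm: "summable (\<lambda>n. \<mu> (D n))" if "\<mu> \<in> ba \<Omega> \<A>" for \<mu>
    using disjoint_abs_summable[OF ba_bfa[OF that] D] by (rule summable_rabs_cancel)
  have "\<bar>\<Sum>n. \<mu> (D n)\<bar> \<le> 1 * ba_norm \<Omega> \<A> \<mu>" if "\<mu> \<in> ba \<Omega> \<A>" for \<mu>
  proof -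
    have "\<bar>\<Sum>n. \<mu> (D n)\<bar> \<le> (\<Sum>n. \<bar>\<mu> (D n)\<bar>)"
      by (intro summable_rabs disjoint_abs_summable[OF ba_bfa[OF that] D])
    also have "\<dots> \<le> tvar \<A> \<mu> \<Omega>"
      by (intro suminf_le_const disjoint_abs_summable[OF ba_bfa[OF that] D] disjoint_sum_abs_le[OF ba_bfa[OF that] D])
    finally show ?thesis
      by (simp add: ba_norm_def)
  qed
  moreover have "(\<Sum>n. a * \<mu> (D n) + b * \<nu> (D n)) = a * (\<Sum>n. \<mu> (D n)) + b * (\<Sum>n. \<nu> (D n))"
    if "\<mu> \<in> ba \<Omega> \<A>" "\<nu> \<in> ba \<Omega> \<A>" for \<mu> \<nu> a b
    using sm[OF that(1)] sm[OF that(2)]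
    by (simp add: suminf_add[symmetric] suminf_mult summable_mult)
  ultimately show ?thesis
    unfolding ba_dual_def by blast
qed

text \<open>The sliding hump is run along a subsequence on which all \<open>\<mu>\<^sub>n(D\<^sub>j)\<close> converge.\<close>

lemma rel_weakly_compact_imp_usa:
  assumes K: "rel_weakly_compact \<Omega> \<A> M" and bdd: "\<And>\<mu>. \<mu> \<in> M \<Longrightarrow> ba_norm \<Omega> \<A> \<mu> \<le> C"
  shows "usa M"
proof (rule ccontr)
  let ?X = "ba_weak \<Omega> \<A>"
  have M: "M \<subseteq> ba \<Omega> \<A>" and comp: "compactin ?X (?X closure_of M)"
    using K by (auto simp: rel_weakly_compact_def)
  assume "\<not> usa M"
  then obtain D \<mu> \<epsilon> where D: "range D \<subseteq> \<A>" "disjoint_family (D :: nat \<Rightarrow> 'a set)" "0 < \<epsilon>"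
    and \<mu>: "\<And>n::nat. \<mu> n \<in> M" and big: "\<And>n. \<epsilon> < \<bar>\<mu> n (D n)\<bar>"
    by (rule not_usaE'[OF _ M]) blast
  have DA: "D n \<in> \<A>" for n
    using D by auto
  have \<mu>ba: "\<mu> n \<in> ba \<Omega> \<A>" and \<mu>bfa: "bfa (\<mu> n)" for n
    using \<mu> M ba_bfa by auto
  have "\<bar>\<mu> n (D j)\<bar> \<le> C" for n j
    using abs_le_tvar[OF \<mu>bfa DA, of n j] ba_norm_bound[OF \<mu>ba DA, of n j] bdd[OF \<mu>, of n] by simp
  then have box: "\<forall>n. (\<lambda>j. \<mu> n (D j)) \<in> {g. \<forall>x. g x \<in> {-C..C}}"
    by (simp add: abs_le_iff minus_le_iff)
  \<comment> \<open>Only the countably many coordinates \<open>D j\<close> are kept; their product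
    is metrizable, so compactness yields a convergent subsequence.\<close>
  have seq: "seq_compact {g :: nat \<Rightarrow> real. \<forall>x. g x \<in> {-C..C}}"
    using compact_function_box compact_eq_seq_compact_metric by blast
  obtain x and r :: "nat \<Rightarrow> nat" where r: "strict_mono r"
    and x: "((\<lambda>n j. \<mu> n (D j)) \<circ> r) \<longlonglongrightarrow> x"
    by (rule seq_compactE[OF seq box])
  have lim: "(\<lambda>k. \<mu> (r k) (D j)) \<longlonglongrightarrow> x j" for j
    using continuous_on_tendsto_compose[OF continuous_on_product_coordinates[of j] x] by (simp add: o_def)
  have sx: "summable (\<lambda>j. \<bar>x j\<bar>)"
  proof (rule summableI_nonneg_bounded)
    show "(\<Sum>j<n. \<bar>x j\<bar>) \<le> C" for n
    proof (rule LIMSEQ_le_const2)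
      show "(\<lambda>k. \<Sum>j<n. \<bar>\<mu> (r k) (D j)\<bar>) \<longlonglongrightarrow> (\<Sum>j<n. \<bar>x j\<bar>)"
        by (intro tendsto_sum tendsto_rabs lim)
      show "\<exists>N. \<forall>k\<ge>N. (\<Sum>j<n. \<bar>\<mu> (r k) (D j)\<bar>) \<le> C"
        using disjoint_sum_abs_le[OF \<mu>bfa D(1,2)] bdd[OF \<mu>] unfolding ba_norm_def by (meson order_trans)
    qed
  qed simp
  \<comment> \<open>Subtracting the limit makes every column tend to 0, as the sliding hump
    requires. Since \<open>x\<close> is in l^1, \<open>x (r k)\<close> tends to 0 and at least half
    of the large entry remains.\<close>
  define z where "z k j = \<mu> (r k) (D j) - x j" for k j
  have zsum: "summable (\<lambda>j. \<bar>z k j\<bar>)" for k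
    using summable_add[OF disjoint_abs_summable[OF \<mu>bfa D(1,2), of "r k"] sx]
    by (rule summable_comparison_test') (auto simp: z_def)
  have zlim: "(\<lambda>k. z k j) \<longlonglongrightarrow> 0" for j
    using tendsto_diff[OF lim[of j] tendsto_const[of "x j"]] by (simp add: z_def)
  have "(\<lambda>j. \<bar>x j\<bar>) \<longlonglongrightarrow> 0"
    by (rule summable_LIMSEQ_zero[OF sx])
  then have "(\<lambda>k. \<bar>x (r k)\<bar>) \<longlonglongrightarrow> 0"
    using filterlim_compose filterlim_subseq[OF r] by blast
  then have "eventually (\<lambda>k. \<bar>x (r k)\<bar> < \<epsilon> / 2) sequentially"
    using D(3) by (intro order_tendstoD) auto
  then have "eventually (\<lambda>k. \<epsilon> / 2 \<le> \<bar>z k (r k)\<bar>) sequentially"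
  proof eventually_elim
    case (elim k)
    then show ?case
      using big[of "r k"] unfolding z_def by linarith
  qed
  then obtain \<kappa> where \<kappa>: "strict_mono (\<kappa> :: nat \<Rightarrow> nat)"
    and hump: "\<And>i. \<epsilon> / 2 / 2 \<le> \<bar>\<Sum>l. z (\<kappa> i) (r (\<kappa> l))\<bar>"
    by (rule sliding_hump[OF zsum zlim r half_gt_zero[OF D(3)]]) blast
  define J where "J l = r (\<kappa> l)" for l
  have injJ: "inj J"
    using strict_mono_eq[OF \<kappa>] strict_mono_eq[OF r] by (auto simp: J_def inj_on_def)
  define \<phi> where "\<phi> \<nu> = (\<Sum>l. \<nu> (D (J l)))" for \<nu> :: "'a set \<Rightarrow> real"
  have DJ: "range (\<lambda>l. D (J l)) \<subseteq> \<A>" "disjoint_family (\<lambda>l. D (J l))"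
    using D injJ by (auto simp: disjoint_family_on_def inj_eq)
  have \<phi>: "\<phi> \<in> ba_dual \<Omega> \<A>"
    unfolding \<phi>_def[abs_def] by (rule disjoint_sum_in_dual[OF DJ])
  have sxJ: "summable (\<lambda>l. x (J l))"
    using summable_reindex[OF sx injJ] by (simp add: o_def summable_rabs_cancel)
  have "\<mu> (J i) \<in> ?X closure_of M" for i
    using closure_of_subset[of M ?X] \<mu> M by auto
  \<comment> \<open>Evaluations force \<open>g (D j) = x j\<close> and thereby the value of
    \<open>\<phi>\<close> at \<open>g\<close>, but along the sequence \<open>\<phi>\<close> stays at
    least \<open>\<epsilon> / 4\<close> away from that value. Both facts reach \<open>g\<close>
    because they are expressed by weakly closed sets.\<close>
  then obtain g where "g \<in> ?X closure_of M"
    and clu: "\<And>S. closedin ?X S \<Longrightarrow> eventually (\<lambda>i. \<mu> (J i) \<in> S) sequentially \<Longrightarrow> g \<in> S"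
    by (rule compactin_cluster_point[OF comp, where f = "\<lambda>i. \<mu> (J i)"]) blast
  have "g (D j) = x j" for j
  proof -
    have "\<bar>g (D j) - x j\<bar> \<le> e" if "0 < e" for e
    proof -
      have "closed {t. \<bar>t - x j\<bar> \<le> e}"
        by (intro closed_Collect_le continuous_intros)
      then have cl: "closedin ?X {\<nu> \<in> ba \<Omega> \<A>. \<nu> (D j) \<in> {t. \<bar>t - x j\<bar> \<le> e}}"
        by (rule closedin_ba_weak[OF eval_in_dual[OF DA]])
      have "(\<lambda>i. \<bar>\<mu> (J i) (D j) - x j\<bar>) \<longlonglongrightarrow> \<bar>x j - x j\<bar>"
        unfolding J_def using LIMSEQ_subseq_LIMSEQ[OF lim \<kappa>, of j]
        by (intro tendsto_intros) (simp add: o_def)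
      then have "eventually (\<lambda>i. \<bar>\<mu> (J i) (D j) - x j\<bar> < e) sequentially"
        using that by (intro order_tendstoD(2)) auto
      then have "eventually (\<lambda>i. \<mu> (J i) \<in> {\<nu> \<in> ba \<Omega> \<A>. \<nu> (D j) \<in> {t. \<bar>t - x j\<bar> \<le> e}}) sequentially"
        by eventually_elim (use \<mu>ba in auto)
      then show ?thesis
        using clu[OF cl] by simp
    qed
    then show ?thesis
      using dense_ge[of 0 "\<bar>g (D j) - x j\<bar>"] by simp
  qed
  then have "\<phi> g = (\<Sum>l. x (J l))"
    by (simp add: \<phi>_def)
  moreover have "\<epsilon> / 4 \<le> \<bar>\<phi> g - (\<Sum>l. x (J l))\<bar>"
  proof -
    have "closed {t. \<epsilon> / 4 \<le> \<bar>t - (\<Sum>l. x (J l))\<bar>}"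
      by (intro closed_Collect_le continuous_intros)
    then have cl: "closedin ?X {\<nu> \<in> ba \<Omega> \<A>. \<phi> \<nu> \<in> {t. \<epsilon> / 4 \<le> \<bar>t - (\<Sum>l. x (J l))\<bar>}}"
      by (rule closedin_ba_weak[OF \<phi>])
    have "\<phi> (\<mu> (J i)) - (\<Sum>l. x (J l)) = (\<Sum>l. z (\<kappa> i) (J l))" for i
      using suminf_diff[OF summable_rabs_cancel[OF disjoint_abs_summable[OF \<mu>bfa DJ]] sxJ, of "J i"]
      by (simp add: \<phi>_def z_def J_def)
    then have "\<epsilon> / 4 \<le> \<bar>\<phi> (\<mu> (J i)) - (\<Sum>l. x (J l))\<bar>" for i
      using hump[of i] by (simp add: J_def)
    then show ?thesis
      using clu[OF cl] \<mu>ba by simp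
  qed
  ultimately show False
    using D(3) by simp
qed

section \<open>Uniform absolute continuity implies weak compactness\<close>

text \<open>Different pairs can give the same block only if it is empty; with
  \<open>g {} = 0\<close> such coincidences do not affect the sum.\<close>

lemma part_sum_common_refinement:
  assumes P: "is_part \<Omega> P" and Q: "is_part \<Omega> Q"
  defines "R \<equiv> (\<lambda>(E, F). E \<inter> F) ` (P \<times> Q)"
  shows "is_part \<Omega> R" "g {} = (0::real) \<Longrightarrow> sum g R = (\<Sum>E\<in>P. \<Sum>F\<in>Q. g (E \<inter> F))"
proof -
  have fin: "finite P" "finite Q" and sub: "P \<subseteq> \<A>" "Q \<subseteq> \<A>" and un: "\<Union>P = \<Omega>" "\<Union>Q = \<Omega>"
    and dP: "\<And>E E'. E \<in> P \<Longrightarrow> E' \<in> P \<Longrightarrow> E \<noteq> E' \<Longrightarrow> E \<inter> E' = {}"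
    and dQ: "\<And>F F'. F \<in> Q \<Longrightarrow> F' \<in> Q \<Longrightarrow> F \<noteq> F' \<Longrightarrow> F \<inter> F' = {}"
    using P Q by (auto simp: is_part_def pairwise_def disjnt_def)
  have disj: "(E \<inter> F) \<inter> (E' \<inter> F') = {}"
    if "E \<in> P" "E' \<in> P" "F \<in> Q" "F' \<in> Q" "(E, F) \<noteq> (E', F')" for E E' F F'
    using that dP[of E E'] dQ[of F F'] by auto
  have "pairwise disjnt R"
  proof (rule pairwiseI)
    fix X Y assume "X \<in> R" "Y \<in> R" "X \<noteq> Y"
    then obtain E F E' F' where "X = E \<inter> F" "Y = E' \<inter> F'" "E \<in> P" "E' \<in> P" "F \<in> Q" "F' \<in> Q" "(E, F) \<noteq> (E', F')"
      by (auto simp: R_def)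
    then show "disjnt X Y"
      using disj[of E E' F F'] by (simp add: disjnt_def)
  qed
  moreover have "\<Union>R = \<Omega>"
    using un by (auto simp: R_def)
  moreover have "finite R" "R \<subseteq> \<A>"
    using fin sub by (auto simp: R_def)
  ultimately show "is_part \<Omega> R"
    by (simp add: is_part_def)
  assume g0: "g {} = 0"
  have "sum g R = (\<Sum>p\<in>P \<times> Q. g ((\<lambda>(E, F). E \<inter> F) p))"
    unfolding R_def
  proof (subst sum.reindex_nontrivial)
    fix p q assume pq: "p \<in> P \<times> Q" "q \<in> P \<times> Q" "p \<noteq> q" "(\<lambda>(E, F). E \<inter> F) p = (\<lambda>(E, F). E \<inter> F) q"
    obtain E F E' F' where "p = (E, F)" "q = (E', F')"
      by fastforce
    then have "(\<lambda>(E, F). E \<inter> F) p = {}"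
      using pq disj[of E E' F F'] by auto
    then show "g ((\<lambda>(E, F). E \<inter> F) p) = 0"
      using g0 by simp
  qed (use fin in auto)
  also have "\<dots> = (\<Sum>E\<in>P. \<Sum>F\<in>Q. g (E \<inter> F))"
    by (simp add: sum.cartesian_product split_def)
  finally show "sum g R = (\<Sum>E\<in>P. \<Sum>F\<in>Q. g (E \<inter> F))" .
qed

text \<open>A finitely additive Radon--Nikodym theorem by energy increment: the energy \<open>\<Sum>\<psi>(E)\<^sup>2/m(E)\<close> grows under refinement and is bounded, and for a nearly maximal partition the
variance of the density on each refinement is small.\<close>

lemma approx_density:
  assumes m: "nonneg m" and \<psi>: "fin_additive \<A> \<psi>" and dom: "\<And>A. A \<in> \<A> \<Longrightarrow> \<bar>\<psi> A\<bar> \<le> K * m A" and \<eta>: "0 < \<eta>"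
  shows "\<exists>P. is_part \<Omega> P \<and> (\<forall>Q. is_part \<Omega> Q \<longrightarrow>
           (\<Sum>F\<in>Q. \<bar>\<psi> F - (\<Sum>E\<in>P. \<psi> E / m E * m (F \<inter> E))\<bar>) \<le> \<eta>)"
proof -
  \<comment> \<open>Since \<open>x / 0 = 0\<close>, blocks with \<open>m E = 0\<close> contribute
    nothing; this is harmless because \<open>\<psi>\<close> vanishes on them.\<close>
  define q where "q P = (\<Sum>E\<in>P. (\<psi> E)\<^sup>2 / m E)" for P
  have null: "\<psi> A = 0" if "A \<in> \<A>" "m A = 0" for A
    using dom[OF that(1)] that by simp
  have q_le: "q P \<le> K\<^sup>2 * m \<Omega>" if P: "is_part \<Omega> P" for P
  proof -
    have "q P \<le> (\<Sum>E\<in>P. K\<^sup>2 * m E)"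
      unfolding q_def
    proof (rule sum_mono)
      fix E assume "E \<in> P"
      then have E: "E \<in> \<A>"
        using P by (auto simp: is_part_def)
      have "(\<psi> E)\<^sup>2 \<le> (K * m E)\<^sup>2"
        using power_mono[OF dom[OF E], of 2] by simp
      then show "(\<psi> E)\<^sup>2 / m E \<le> K\<^sup>2 * m E"
        using nonneg_ge[OF m E] by (cases "m E = 0") (auto simp: field_simps power2_eq_square)
    qed
    also have "\<dots> = K\<^sup>2 * m \<Omega>"
      using fin_additive_part'[OF nonneg_add[OF m] P] by (simp add: sum_distrib_left[symmetric])
    finally show ?thesis .
  qed
  let ?\<P> = "{P. is_part \<Omega> P}"
  have bdd: "bdd_above (q ` ?\<P>)"
    using q_le by (intro bdd_aboveI[of _ "K\<^sup>2 * m \<Omega>"]) auto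
  have ne: "?\<P> \<noteq> {}"
    using is_part_single[OF top] by auto
  have m\<Omega>: "0 \<le> m \<Omega>"
    using nonneg_ge[OF m top] .
  \<comment> \<open>Where the density deviates by at most \<open>t\<close>, the error totals at most
    \<open>t * m \<Omega>\<close>, hence \<open>\<eta> / 2\<close>. Elsewhere |u| is at most u^2 /
    t, so an energy gap of at most \<open>t * \<eta> / 2\<close> costs another
    \<open>\<eta> / 2\<close>.\<close>
  define t where "t = \<eta> / (2 * (m \<Omega> + 1))"
  have t: "0 < t" "t * m \<Omega> \<le> \<eta> / 2"
    using \<eta> m\<Omega> by (auto simp: t_def field_simps)
  have "(SUP P\<in>?\<P>. q P) - t * \<eta> / 2 < (SUP P\<in>?\<P>. q P)"
    using t \<eta> by simp
  then obtain P where P: "is_part \<Omega> P" and qP: "(SUP P\<in>?\<P>. q P) - t * \<eta> / 2 < q P"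
    using less_cSUP_iff[OF ne bdd] by auto
  have PA: "E \<in> \<A>" if "E \<in> P" for E
    using P that by (auto simp: is_part_def)
  have "(\<Sum>F\<in>Q. \<bar>\<psi> F - (\<Sum>E\<in>P. \<psi> E / m E * m (F \<inter> E))\<bar>) \<le> \<eta>" if Q: "is_part \<Omega> Q" for Q
  proof -
    have QA: "F \<in> \<A>" if "F \<in> Q" for F
      using Q that by (auto simp: is_part_def)
    define u where "u E F = \<psi> (E \<inter> F) / m (E \<inter> F) - \<psi> E / m E" for E F
    \<comment> \<open>Pythagoras in L^2(m): the energy gained by splitting \<open>E\<close> is the
      weighted squared deviation of the new densities from the old one.\<close>
    have var: "(\<Sum>F\<in>Q. m (E \<inter> F) * (u E F)\<^sup>2) = (\<Sum>F\<in>Q. (\<psi> (E \<inter> F))\<^sup>2 / m (E \<inter> F)) - (\<psi> E)\<^sup>2 / m E"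
      if E: "E \<in> P" for E
    proof -
      let ?x = "\<psi> E / m E"
      have sub: "E \<subseteq> \<Omega>"
        using sets_into_space[OF PA[OF E]] .
      have "m (E \<inter> F) * (u E F)\<^sup>2 = (\<psi> (E \<inter> F))\<^sup>2 / m (E \<inter> F) - 2 * ?x * \<psi> (E \<inter> F) + ?x\<^sup>2 * m (E \<inter> F)"
        if "F \<in> Q" for F
      proof (cases "m (E \<inter> F) = 0")
        case True
        then show ?thesis
          using null[OF Int[OF PA[OF E] QA[OF that]]] by simp
      next
        case False
        have "b * (a / b - x)\<^sup>2 = a\<^sup>2 / b - 2 * x * a + x\<^sup>2 * b" if "b \<noteq> 0" for a b x :: real
          using that by (simp add: power2_eq_square field_simps)
        from this[OF False] show ?thesis
          by (simp add: u_def)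
      qed
      then have "(\<Sum>F\<in>Q. m (E \<inter> F) * (u E F)\<^sup>2) =
          (\<Sum>F\<in>Q. (\<psi> (E \<inter> F))\<^sup>2 / m (E \<inter> F) - 2 * ?x * \<psi> (E \<inter> F) + ?x\<^sup>2 * m (E \<inter> F))"
        by (intro sum.cong) auto
      also have "\<dots> = (\<Sum>F\<in>Q. (\<psi> (E \<inter> F))\<^sup>2 / m (E \<inter> F)) - 2 * ?x * \<psi> E + ?x\<^sup>2 * m E"
        by (simp only: sum.distrib sum_subtractf sum_distrib_left[symmetric]
            fin_additive_part[OF \<psi> Q PA[OF E] sub] fin_additive_part[OF nonneg_add[OF m] Q PA[OF E] sub])
      also have "\<dots> = (\<Sum>F\<in>Q. (\<psi> (E \<inter> F))\<^sup>2 / m (E \<inter> F)) - (\<psi> E)\<^sup>2 / m E"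
        by (cases "m E = 0") (simp_all add: power2_eq_square field_simps)
      finally show ?thesis .
    qed
    have tot: "(\<Sum>E\<in>P. \<Sum>F\<in>Q. m (E \<inter> F)) = m \<Omega>"
      using fin_additive_part[OF nonneg_add[OF m] Q] PA sets_into_space
        fin_additive_part'[OF nonneg_add[OF m] P] by simp
    let ?R = "(\<lambda>(E, F). E \<inter> F) ` (P \<times> Q)"
    have "q ?R = (\<Sum>E\<in>P. \<Sum>F\<in>Q. (\<psi> (E \<inter> F))\<^sup>2 / m (E \<inter> F))"
      unfolding q_def using fin_additive_empty[OF \<psi>] by (intro part_sum_common_refinement(2)[OF P Q]) simp
    moreover have "q ?R \<le> (SUP P\<in>?\<P>. q P)"
      using part_sum_common_refinement(1)[OF P Q] bdd by (intro cSUP_upper) auto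
    ultimately have D: "(\<Sum>E\<in>P. \<Sum>F\<in>Q. m (E \<inter> F) * (u E F)\<^sup>2) \<le> t * \<eta> / 2"
      using qP by (simp add: var sum_subtractf q_def)
    have pt: "\<bar>\<psi> (E \<inter> F) - \<psi> E / m E * m (E \<inter> F)\<bar> \<le> t * m (E \<inter> F) + m (E \<inter> F) * (u E F)\<^sup>2 / t"
      if "E \<in> P" "F \<in> Q" for E F
    proof (cases "m (E \<inter> F) = 0")
      case True
      then show ?thesis
        using null[OF Int[OF PA[OF that(1)] QA[OF that(2)]]] by simp
    next
      case False
      have m0: "0 \<le> m (E \<inter> F)"
        using PA QA that by (intro nonneg_ge[OF m]) auto
      have "\<bar>u E F\<bar> \<le> t + (u E F)\<^sup>2 / t"
      proof (cases "\<bar>u E F\<bar> \<le> t")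
        case True
        moreover have "0 \<le> (u E F)\<^sup>2 / t"
          using t by simp
        ultimately show ?thesis
          by linarith
      next
        case False
        then have "\<bar>u E F\<bar> * t \<le> \<bar>u E F\<bar> * \<bar>u E F\<bar>"
          by (intro mult_left_mono) auto
        then have "\<bar>u E F\<bar> \<le> (u E F)\<^sup>2 / t"
          using t by (simp add: field_simps power2_eq_square)
        then show ?thesis
          using t by simp
      qed
      then have "m (E \<inter> F) * \<bar>u E F\<bar> \<le> m (E \<inter> F) * (t + (u E F)\<^sup>2 / t)"
        using m0 by (intro mult_left_mono)
      moreover have "\<psi> (E \<inter> F) - \<psi> E / m E * m (E \<inter> F) = m (E \<inter> F) * u E F"
        using False by (simp add: u_def right_diff_distrib)
      ultimately show ?thesis
        using m0 by (simp add: abs_mult distrib_left mult.commute)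
    qed
    have "(\<Sum>F\<in>Q. \<bar>\<psi> F - (\<Sum>E\<in>P. \<psi> E / m E * m (F \<inter> E))\<bar>) \<le>
        (\<Sum>F\<in>Q. \<Sum>E\<in>P. \<bar>\<psi> (E \<inter> F) - \<psi> E / m E * m (E \<inter> F)\<bar>)"
    proof (rule sum_mono)
      fix F assume F: "F \<in> Q"
      have "\<psi> F - (\<Sum>E\<in>P. \<psi> E / m E * m (F \<inter> E)) = (\<Sum>E\<in>P. \<psi> (E \<inter> F) - \<psi> E / m E * m (E \<inter> F))"
        using fin_additive_part[OF \<psi> P QA[OF F] sets_into_space[OF QA[OF F]]]
        by (simp add: sum_subtractf Int_commute)
      then show "\<bar>\<psi> F - (\<Sum>E\<in>P. \<psi> E / m E * m (F \<inter> E))\<bar> \<le> (\<Sum>E\<in>P. \<bar>\<psi> (E \<inter> F) - \<psi> E / m E * m (E \<inter> F)\<bar>)"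
        by simp
    qed
    also have "\<dots> = (\<Sum>E\<in>P. \<Sum>F\<in>Q. \<bar>\<psi> (E \<inter> F) - \<psi> E / m E * m (E \<inter> F)\<bar>)"
      by (rule sum.swap)
    also have "\<dots> \<le> (\<Sum>E\<in>P. \<Sum>F\<in>Q. t * m (E \<inter> F) + m (E \<inter> F) * (u E F)\<^sup>2 / t)"
      using pt by (intro sum_mono)
    also have "\<dots> = t * (\<Sum>E\<in>P. \<Sum>F\<in>Q. m (E \<inter> F)) + (\<Sum>E\<in>P. \<Sum>F\<in>Q. m (E \<inter> F) * (u E F)\<^sup>2) / t"
      by (simp add: sum.distrib sum_distrib_left sum_divide_distrib)
    also have "\<dots> \<le> \<eta> / 2 + \<eta> / 2"
      unfolding tot using t D by (intro add_mono) (auto simp: field_simps)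
    finally show ?thesis
      by simp
  qed
  then show ?thesis
    using P by blast
qed

section \<open>Approximating dual functionals by finite combinations of evaluations\<close>

lemma ba_lincomb:
  assumes "\<mu> \<in> ba \<Omega> \<A>" "\<nu> \<in> ba \<Omega> \<A>"
  shows "(\<lambda>B. a * \<mu> B + b * \<nu> B) \<in> ba \<Omega> \<A>"
  using assms bfa_lincomb by (auto simp: ba_iff)

lemma dual_lincomb:
  assumes "\<phi> \<in> ba_dual \<Omega> \<A>" "\<mu> \<in> ba \<Omega> \<A>" "\<nu> \<in> ba \<Omega> \<A>"
  shows "\<phi> (\<lambda>B. a * \<mu> B + b * \<nu> B) = a * \<phi> \<mu> + b * \<phi> \<nu>"
  using assms by (simp add: ba_dual_def)

lemma zero_in_ba: "(\<lambda>_. 0) \<in> ba \<Omega> \<A>"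
  by (auto simp: ba_def fin_additive_def)

lemma dual_sum:
  assumes \<phi>: "\<phi> \<in> ba_dual \<Omega> \<A>" and "finite I" "\<And>i. i \<in> I \<Longrightarrow> \<mu> i \<in> ba \<Omega> \<A>"
  shows "(\<lambda>B. \<Sum>i\<in>I. c i * \<mu> i B) \<in> ba \<Omega> \<A> \<and> \<phi> (\<lambda>B. \<Sum>i\<in>I. c i * \<mu> i B) = (\<Sum>i\<in>I. c i * \<phi> (\<mu> i))"
  using assms(2,3)
proof (induction I rule: finite_induct)
  case empty
  then show ?case
    using dual_lincomb[OF \<phi> zero_in_ba zero_in_ba, of 0 0] zero_in_ba by simp
next
  case (insert i I)
  have "(\<lambda>B. \<Sum>j\<in>insert i I. c j * \<mu> j B) = (\<lambda>B. c i * \<mu> i B + 1 * (\<Sum>j\<in>I. c j * \<mu> j B))"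
    using insert by simp
  then show ?case
    using insert dual_lincomb[OF \<phi>, of "\<mu> i" "\<lambda>B. \<Sum>j\<in>I. c j * \<mu> j B" "c i" 1]
      ba_lincomb[of "\<mu> i" "\<lambda>B. \<Sum>j\<in>I. c j * \<mu> j B" "c i" 1] by simp
qed

lemma dual_bound:
  assumes "\<phi> \<in> ba_dual \<Omega> \<A>"
  obtains L where "0 \<le> L" "\<And>\<mu>. \<mu> \<in> ba \<Omega> \<A> \<Longrightarrow> \<bar>\<phi> \<mu>\<bar> \<le> L * tvar \<A> \<mu> \<Omega>"
proof -
  obtain C where C: "\<And>\<mu>. \<mu> \<in> ba \<Omega> \<A> \<Longrightarrow> \<bar>\<phi> \<mu>\<bar> \<le> C * tvar \<A> \<mu> \<Omega>"
    using assms unfolding ba_dual_def ba_norm_def by blast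
  have "\<bar>\<phi> \<mu>\<bar> \<le> max C 0 * tvar \<A> \<mu> \<Omega>" if "\<mu> \<in> ba \<Omega> \<A>" for \<mu>
  proof -
    have "C * tvar \<A> \<mu> \<Omega> \<le> max C 0 * tvar \<A> \<mu> \<Omega>"
      using nonneg_ge[OF tvar_nonneg[OF ba_bfa[OF that]] top] by (intro mult_right_mono) auto
    then show ?thesis
      using C[OF that] by simp
  qed
  then show ?thesis
    using that[of "max C 0"] by simp
qed

lemma part_comb_le:
  assumes "bfa d" "is_part \<Omega> P" "\<And>E. E \<in> P \<Longrightarrow> \<bar>c E\<bar> \<le> L" "0 \<le> L"
  shows "\<bar>\<Sum>E\<in>P. c E * d E\<bar> \<le> L * tvar \<A> d \<Omega>"
proof -
  have "\<bar>\<Sum>E\<in>P. c E * d E\<bar> \<le> (\<Sum>E\<in>P. L * \<bar>d E\<bar>)"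
    using assms(3) by (intro order_trans[OF sum_abs] sum_mono) (simp add: abs_mult mult_right_mono)
  also have "\<dots> \<le> L * tvar \<A> d \<Omega>"
    using part_sum_le_tvar[OF assms(1,2)] assms(4) by (simp add: sum_distrib_left[symmetric] mult_left_mono)
  finally show ?thesis .
qed

text \<open>Why it works: both the functional, through \<open>\<psi>(A) = \<phi>(m(\<cdot> \<inter> A))\<close>, and the elements of the interval have approximate densities
with respect to \<open>m\<close>.\<close>

lemma dual_approx_dominated:
  assumes m: "nonneg m" and \<phi>: "\<phi> \<in> ba_dual \<Omega> \<A>" and L: "0 \<le> L"
    and \<phi>L: "\<And>\<mu>. \<mu> \<in> ba \<Omega> \<A> \<Longrightarrow> \<bar>\<phi> \<mu>\<bar> \<le> L * tvar \<A> \<mu> \<Omega>" and K: "0 \<le> K" and \<eta>: "0 < \<eta>"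
  shows "\<exists>P c. is_part \<Omega> P \<and> (\<forall>E\<in>P. \<bar>c E\<bar> \<le> L) \<and>
     (\<forall>\<mu>\<in>ba \<Omega> \<A>. (\<forall>A\<in>\<A>. \<bar>\<mu> A\<bar> \<le> K * m A) \<longrightarrow> \<bar>\<phi> \<mu> - (\<Sum>E\<in>P. c E * \<mu> E)\<bar> \<le> \<eta>)"
proof -
  define r where "r A = rst (\<lambda>B. m (B \<inter> A))" for A
  have r_nn: "nonneg (\<lambda>B. m (B \<inter> A))" if "A \<in> \<A>" for A
  proof -
    have "m ((B \<union> B') \<inter> A) = m (B \<inter> A) + m (B' \<inter> A)" if "B \<in> \<A>" "B' \<in> \<A>" "B \<inter> B' = {}" for B B'
      unfolding Int_Un_distrib2 using that \<open>A \<in> \<A>\<close> by (intro fin_additiveD[OF nonneg_add[OF m]]) auto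
    then show ?thesis
      using nonneg_ge[OF m Int[OF _ that]] by (auto simp: nonneg_def fin_additive_def)
  qed
  have r_ba: "r A \<in> ba \<Omega> \<A>" if "A \<in> \<A>" for A
    unfolding r_def by (intro rst_ba nonneg_bfa r_nn that)
  have r_norm: "tvar \<A> (r A) \<Omega> = m A" if "A \<in> \<A>" for A
    using tvar_of_nonneg[OF r_nn[OF that] top] sets_into_space[OF that] by (simp add: r_def Int_absorb1)
  define \<psi> where "\<psi> A = \<phi> (r A)" for A
  have \<psi>_add: "fin_additive \<A> \<psi>"
    unfolding fin_additive_def
  proof (intro ballI impI)
    fix A A' assume A: "A \<in> \<A>" "A' \<in> \<A>" "A \<inter> A' = {}"
    have "r (A \<union> A') = (\<lambda>B. 1 * r A B + 1 * r A' B)"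
    proof
      fix B
      have "m (B \<inter> (A \<union> A')) = m (B \<inter> A) + m (B \<inter> A')" if "B \<in> \<A>"
        unfolding Int_Un_distrib using that A by (intro fin_additiveD[OF nonneg_add[OF m]]) auto
      then show "r (A \<union> A') B = 1 * r A B + 1 * r A' B"
        by (simp add: r_def rst_def)
    qed
    then show "\<psi> (A \<union> A') = \<psi> A + \<psi> A'"
      using dual_lincomb[OF \<phi> r_ba[OF A(1)] r_ba[OF A(2)], of 1 1] by (simp add: \<psi>_def)
  qed
  have \<psi>_le: "\<bar>\<psi> A\<bar> \<le> L * m A" if "A \<in> \<A>" for A
    using \<phi>L[OF r_ba[OF that]] r_norm[OF that] by (simp add: \<psi>_def)
  define \<eta>' where "\<eta>' = \<eta> / (2 * (K + 1))"
  have \<eta>': "0 < \<eta>'" "K * \<eta>' \<le> \<eta> / 2"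
    using K \<eta> by (auto simp: \<eta>'_def field_simps)
  obtain P where P: "is_part \<Omega> P"
    and approx: "\<And>Q. is_part \<Omega> Q \<Longrightarrow> (\<Sum>F\<in>Q. \<bar>\<psi> F - (\<Sum>E\<in>P. \<psi> E / m E * m (F \<inter> E))\<bar>) \<le> \<eta>'"
    using approx_density[OF m \<psi>_add \<psi>_le \<eta>'(1)] by blast
  have PA: "E \<in> \<A>" if "E \<in> P" for E
    using P that by (auto simp: is_part_def)
  \<comment> \<open>If \<open>\<phi>\<close> were integration of densities against some h, then
    \<open>\<psi>\<close> would be the indefinite integral of h and \<open>c E\<close> its average
    over \<open>E\<close>.\<close>
  define c where "c E = \<psi> E / m E" for E
  have ratio: "\<bar>a / b\<bar> \<le> k" if "\<bar>a\<bar> \<le> k * b" "0 \<le> b" "0 \<le> k" for a b k :: real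
    using that by (cases "b = 0") (auto simp: field_simps abs_divide)
  have c: "\<bar>c E\<bar> \<le> L" if "E \<in> P" for E
    unfolding c_def using \<psi>_le[OF PA[OF that]] nonneg_ge[OF m PA[OF that]] L by (rule ratio)
  have "\<bar>\<phi> \<mu> - (\<Sum>E\<in>P. c E * \<mu> E)\<bar> \<le> \<eta>"
    if \<mu>: "\<mu> \<in> ba \<Omega> \<A>" and dom: "\<And>A. A \<in> \<A> \<Longrightarrow> \<bar>\<mu> A\<bar> \<le> K * m A" for \<mu>
  proof -
    \<comment> \<open>Replacing \<open>\<mu>\<close> by a step density is paid for twice, through
      \<open>\<phi>\<close> and through the finite combination, each time with at most
      \<open>L * \<kappa>\<close>.\<close>
    define \<kappa> where "\<kappa> = \<eta> / (4 * (L + 1))"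
    have \<kappa>: "0 < \<kappa>" "2 * (L * \<kappa>) \<le> \<eta> / 2"
      using L \<eta> by (auto simp: \<kappa>_def field_simps)
    obtain Q where Q: "is_part \<Omega> Q"
      and approx': "\<And>R. is_part \<Omega> R \<Longrightarrow> (\<Sum>F\<in>R. \<bar>\<mu> F - (\<Sum>E\<in>Q. \<mu> E / m E * m (F \<inter> E))\<bar>) \<le> \<kappa>"
      using approx_density[OF m bfa_add[OF ba_bfa[OF \<mu>]] dom \<kappa>(1)] by blast
    have QA: "F \<in> \<A>" if "F \<in> Q" for F
      using Q that by (auto simp: is_part_def)
    have finQ: "finite Q"
      using Q by (simp add: is_part_def)
    define x where "x F = \<mu> F / m F" for F
    have x: "\<bar>x F\<bar> \<le> K" if "F \<in> Q" for F
      unfolding x_def using dom[OF QA[OF that]] nonneg_ge[OF m QA[OF that]] K by (rule ratio)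
    define \<nu> where "\<nu> = (\<lambda>B. \<Sum>F\<in>Q. x F * r F B)"
    have \<nu>: "\<nu> \<in> ba \<Omega> \<A>" and \<phi>\<nu>: "\<phi> \<nu> = (\<Sum>F\<in>Q. x F * \<psi> F)"
      unfolding \<nu>_def \<psi>_def using dual_sum[OF \<phi> finQ, of r x] r_ba[OF QA] by auto
    have \<nu>_eq: "\<nu> B = (\<Sum>F\<in>Q. x F * m (B \<inter> F))" if "B \<in> \<A>" for B
      using that by (simp add: \<nu>_def r_def)
    define d where "d = (\<lambda>B. 1 * \<mu> B + (-1) * \<nu> B)"
    have d: "d \<in> ba \<Omega> \<A>"
      unfolding d_def by (rule ba_lincomb[OF \<mu> \<nu>])
    have d_norm: "tvar \<A> d \<Omega> \<le> \<kappa>"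
    proof (rule tvar_le[OF top])
      fix R assume R: "is_part \<Omega> R"
      have "(\<Sum>B\<in>R. \<bar>d B\<bar>) = (\<Sum>F\<in>R. \<bar>\<mu> F - (\<Sum>E\<in>Q. \<mu> E / m E * m (F \<inter> E))\<bar>)"
        using R by (intro sum.cong) (auto simp: d_def \<nu>_eq x_def is_part_def)
      then show "(\<Sum>B\<in>R. \<bar>d B\<bar>) \<le> \<kappa>"
        using approx'[OF R] by simp
    qed
    have \<phi>d: "\<phi> d = \<phi> \<mu> - \<phi> \<nu>"
      unfolding d_def using dual_lincomb[OF \<phi> \<mu> \<nu>, of 1 "-1"] by simp
    have gd: "(\<Sum>E\<in>P. c E * d E) = (\<Sum>E\<in>P. c E * \<mu> E) - (\<Sum>E\<in>P. c E * \<nu> E)"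
      by (simp add: d_def sum_subtractf right_diff_distrib)
    have Lk: "L * tvar \<A> d \<Omega> \<le> L * \<kappa>"
      using L d_norm by (intro mult_left_mono)
    have 1: "\<bar>\<phi> d\<bar> \<le> L * \<kappa>"
      using \<phi>L[OF d] Lk by simp
    have 2: "\<bar>\<Sum>E\<in>P. c E * d E\<bar> \<le> L * \<kappa>"
      using part_comb_le[OF ba_bfa[OF d] P, of c L] c L Lk by simp
    \<comment> \<open>After swapping the sums, the error at \<open>\<nu>\<close> is the density
      defect of \<open>\<psi>\<close> on the blocks of \<open>Q\<close>, weighted by at most
      \<open>K\<close>. \<open>Q\<close> depends on \<open>\<mu>\<close>, but \<open>approx\<close>
      holds for the fixed \<open>P\<close> against every partition, so the estimate is
      uniform.\<close>
    have "(\<Sum>E\<in>P. c E * \<nu> E) = (\<Sum>E\<in>P. \<Sum>F\<in>Q. c E * (x F * m (E \<inter> F)))"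
      using PA by (intro sum.cong) (auto simp: \<nu>_eq sum_distrib_left)
    also have "\<dots> = (\<Sum>F\<in>Q. \<Sum>E\<in>P. c E * (x F * m (E \<inter> F)))"
      by (rule sum.swap)
    also have "\<dots> = (\<Sum>F\<in>Q. x F * (\<Sum>E\<in>P. \<psi> E / m E * m (F \<inter> E)))"
      by (simp add: sum_distrib_left c_def Int_commute mult_ac)
    finally have "\<phi> \<nu> - (\<Sum>E\<in>P. c E * \<nu> E) = (\<Sum>F\<in>Q. x F * (\<psi> F - (\<Sum>E\<in>P. \<psi> E / m E * m (F \<inter> E))))"
      unfolding \<phi>\<nu> by (simp add: sum_subtractf right_diff_distrib)
    also have "\<bar>\<dots>\<bar> \<le> (\<Sum>F\<in>Q. K * \<bar>\<psi> F - (\<Sum>E\<in>P. \<psi> E / m E * m (F \<inter> E))\<bar>)"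
      using x by (intro order_trans[OF sum_abs] sum_mono) (simp add: abs_mult mult_right_mono)
    also have "\<dots> \<le> K * \<eta>'"
      using approx[OF Q] K by (simp add: sum_distrib_left[symmetric] mult_left_mono)
    finally have "\<bar>\<phi> \<nu> - (\<Sum>E\<in>P. c E * \<nu> E)\<bar> \<le> \<eta> / 2"
      using \<eta>' by simp
    then show ?thesis
      using 1 2 \<kappa>(2) unfolding \<phi>d gd by linarith
  qed
  then show ?thesis
    using P c by blast
qed

text \<open>\<open>e\<close> is the positive part of v - K m, so removing it from v leaves at most K
  m. Its total mass is at most \<open>s\<close>: if \<open>m B \<ge> \<delta>\<close>, then K m(B)
  exceeds C and the difference is negative; otherwise already \<open>v B \<le> s\<close>.\<close>

lemma excess:
  assumes v: "nonneg v" and m: "nonneg m" and K: "0 < K"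
    and bound: "\<forall>A\<in>\<A>. v A \<le> C" and ac: "\<forall>A\<in>\<A>. m A < \<delta> \<longrightarrow> v A \<le> s"
    and "0 \<le> s" "C / K < \<delta>"
  defines "e \<equiv> upvar (\<lambda>B. v B - K * m B)"
  shows "nonneg e" "A \<in> \<A> \<Longrightarrow> e A \<le> v A" "A \<in> \<A> \<Longrightarrow> v A - e A \<le> K * m A" "e \<Omega> \<le> s"
proof -
  have bfa: "bfa (\<lambda>B. v B - K * m B)"
    using bfa_lincomb[OF nonneg_bfa[OF v] nonneg_bfa[OF m], of 1 "-K"] by simp
  show "nonneg e"
    unfolding e_def by (rule upvar_nonneg[OF bfa])
  show "e A \<le> v A" if "A \<in> \<A>"
    unfolding e_def
  proof (rule upvar_le)
    fix B assume B: "B \<in> \<A>" "B \<subseteq> A"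
    have "v B \<le> v A"
      using B that by (intro nonneg_mono[OF v])
    moreover have "0 \<le> K * m B"
      using K nonneg_ge[OF m B(1)] by simp
    ultimately show "v B - K * m B \<le> v A"
      by simp
  qed
  show "v A - e A \<le> K * m A" if "A \<in> \<A>"
    using upvar_ge[OF bfa that, of A] by (simp add: e_def)
  show "e \<Omega> \<le> s"
    unfolding e_def
  proof (rule upvar_le)
    fix B assume B: "B \<in> \<A>" "B \<subseteq> \<Omega>"
    show "v B - K * m B \<le> s"
    proof (cases "m B < \<delta>")
      case True
      moreover have "0 \<le> K * m B"
        using K nonneg_ge[OF m B(1)] by simp
      ultimately show ?thesis
        using ac B(1) by force
    next
      case False
      then have "C / K < m B"
        using assms by simp
      then have "C < K * m B"
        using K by (simp add: field_simps)
      then show ?thesis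
        using bound B(1) \<open>0 \<le> s\<close> by force
    qed
  qed
qed

lemma tvar_diff_le:
  assumes "nonneg f" "nonneg g" "A \<in> \<A>"
  shows "tvar \<A> (\<lambda>B. f B - g B) A \<le> f A + g A"
proof (rule tvar_le[OF assms(3)])
  fix P assume P: "is_part A P"
  have "(\<Sum>B\<in>P. \<bar>f B - g B\<bar>) \<le> (\<Sum>B\<in>P. f B + g B)"
  proof (rule sum_mono)
    fix B assume "B \<in> P"
    then have "B \<in> \<A>"
      using P by (auto simp: is_part_def)
    then show "\<bar>f B - g B\<bar> \<le> f B + g B"
      using nonneg_ge[OF assms(1)] nonneg_ge[OF assms(2)] by (simp add: abs_le_iff)
  qed
  also have "\<dots> = f A + g A"
    using fin_additive_part'[OF nonneg_add[OF assms(1)] P] fin_additive_part'[OF nonneg_add[OF assms(2)] P]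
    by (simp add: sum.distrib)
  finally show "(\<Sum>B\<in>P. \<bar>f B - g B\<bar>) \<le> f A + g A" .
qed

text \<open>Both Jordan parts are cut at \<open>K * m\<close> separately. The negative part, formed
  as \<open>p A - \<mu> A\<close>, only inherits the bounds 2 C and 2 s; hence the condition on
  \<open>2 * C / K\<close> and the distance s + 2 s.\<close>

lemma truncation:
  assumes \<mu>: "\<mu> \<in> ba \<Omega> \<A>" and m: "nonneg m" and K: "0 < K"
    and bound: "\<And>A. A \<in> \<A> \<Longrightarrow> \<bar>\<mu> A\<bar> \<le> C" and ac: "\<And>A. A \<in> \<A> \<Longrightarrow> m A < \<delta> \<Longrightarrow> \<bar>\<mu> A\<bar> \<le> s"
    and s: "0 \<le> s" and C: "2 * C / K < \<delta>"
  obtains \<nu> where "\<nu> \<in> ba \<Omega> \<A>" "\<forall>A\<in>\<A>. \<bar>\<nu> A\<bar> \<le> K * m A" "tvar \<A> (\<lambda>B. 1 * \<mu> B + (-1) * \<nu> B) \<Omega> \<le> 3 * s"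
proof -
  have bfa: "bfa \<mu>"
    by (rule ba_bfa[OF \<mu>])
  have C0: "0 \<le> C"
    using bound[OF top] by simp
  define p where "p = upvar \<mu>"
  define n where "n = (\<lambda>A. p A - \<mu> A)"
  have p_nn: "nonneg p"
    unfolding p_def by (rule upvar_nonneg[OF bfa])
  have n_nn: "nonneg n"
    using upvar_ge[OF bfa] nonneg_add[OF p_nn] bfa_add[OF bfa]
    by (auto simp: nonneg_def n_def p_def fin_additive_def)
  have p_le: "p A \<le> C" if "A \<in> \<A>" for A
    unfolding p_def using bound by (intro upvar_le) (meson abs_ge_self order_trans)
  have n_le: "n A \<le> 2 * C" if "A \<in> \<A>" for A
    using p_le[OF that] bound[OF that] by (simp add: n_def)
  have p_ac: "p A \<le> s" if A: "A \<in> \<A>" "m A < \<delta>" for A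
    unfolding p_def
  proof (rule upvar_le)
    fix B assume B: "B \<in> \<A>" "B \<subseteq> A"
    then have "m B < \<delta>"
      using nonneg_mono[OF m B(1) A(1) B(2)] A by simp
    then show "\<mu> B \<le> s"
      using ac[OF B(1)] by simp
  qed
  have n_ac: "n A \<le> 2 * s" if "A \<in> \<A>" "m A < \<delta>" for A
    using p_ac[OF that] ac[OF that] by (simp add: n_def)
  have C': "C / K < \<delta>"
    using C C0 K by (simp add: field_simps)
  have s2: "0 \<le> 2 * s"
    using s by simp
  define ep where "ep = upvar (\<lambda>B. p B - K * m B)"
  define en where "en = upvar (\<lambda>B. n B - K * m B)"
  have "\<forall>A\<in>\<A>. p A \<le> C" "\<forall>A\<in>\<A>. m A < \<delta> \<longrightarrow> p A \<le> s"
    using p_le p_ac by auto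
  note ep = excess[OF p_nn m K this s C', folded ep_def]
  have "\<forall>A\<in>\<A>. n A \<le> 2 * C" "\<forall>A\<in>\<A>. m A < \<delta> \<longrightarrow> n A \<le> 2 * s"
    using n_le n_ac by auto
  note en = excess[OF n_nn m K this s2 C, folded en_def]
  define \<nu> where "\<nu> = rst (\<lambda>A. (p A - ep A) - (n A - en A))"
  have \<nu>: "\<nu> \<in> ba \<Omega> \<A>"
    unfolding \<nu>_def by (intro rst_ba bfa_diff nonneg_bfa p_nn n_nn ep(1) en(1))
  have dom: "\<bar>\<nu> A\<bar> \<le> K * m A" if "A \<in> \<A>" for A
    using ep(2,3)[OF that] en(2,3)[OF that] that by (simp add: \<nu>_def abs_le_iff)
  have "tvar \<A> (\<lambda>B. 1 * \<mu> B + (-1) * \<nu> B) \<Omega> = tvar \<A> (\<lambda>B. ep B - en B) \<Omega>"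
    by (rule tvar_cong) (simp add: \<nu>_def n_def)
  also have "\<dots> \<le> ep \<Omega> + en \<Omega>"
    by (intro tvar_diff_le ep(1) en(1) top)
  finally show ?thesis
    using that[OF \<nu>] dom ep(4) en(4) by simp
qed

section \<open>A setwise compact set on which the weak topology is no finer\<close>

text \<open>Non-strict bounds on values, in place of strict ones on variations, make each condition
  closed under setwise convergence. The modulus \<open>\<delta>\<close> is a fixed function, so that
  continuity is uniform over the set.\<close>

definition uac_ball :: "('a set \<Rightarrow> real) \<Rightarrow> real \<Rightarrow> (real \<Rightarrow> real) \<Rightarrow> ('a set \<Rightarrow> real) set" where
  "uac_ball m C \<delta> = {\<mu>. (\<forall>B. B \<notin> \<A> \<longrightarrow> \<mu> B = 0) \<and> fin_additive \<A> \<mu> \<and> (\<forall>B\<in>\<A>. \<bar>\<mu> B\<bar> \<le> C) \<and>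
     (\<forall>\<epsilon>>0. \<forall>A\<in>\<A>. m A < \<delta> \<epsilon> \<longrightarrow> \<bar>\<mu> A\<bar> \<le> \<epsilon>)}"

lemma uac_ball_ba: "uac_ball m C \<delta> \<subseteq> ba \<Omega> \<A>"
  by (auto simp: uac_ball_def ba_def)

text \<open>One \<open>K\<close> truncates all members of the ball, moving each by at most
  \<open>3 * s\<close> in norm; a combination that works for the dominated charges therefore serves
  the whole ball.\<close>

lemma dual_approx_uac:
  assumes m: "nonneg m" and \<phi>: "\<phi> \<in> ba_dual \<Omega> \<A>" and C: "0 \<le> C" and \<delta>: "\<And>\<epsilon>. 0 < \<epsilon> \<Longrightarrow> 0 < \<delta> \<epsilon>" and \<eta>: "0 < \<eta>"
  shows "\<exists>P c. \<forall>\<mu>\<in>uac_ball m C \<delta>. \<bar>\<phi> \<mu> - (\<Sum>E\<in>P. c E * \<mu> E)\<bar> \<le> \<eta>"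
proof -
  obtain L where L: "0 \<le> L" and \<phi>L: "\<And>\<mu>. \<mu> \<in> ba \<Omega> \<A> \<Longrightarrow> \<bar>\<phi> \<mu>\<bar> \<le> L * tvar \<A> \<mu> \<Omega>"
    using dual_bound[OF \<phi>] by blast
  \<comment> \<open>The distance \<open>3 * s\<close> enters once through \<open>\<phi>\<close> and
    once through the combination, each time multiplied by \<open>L\<close>; the two together must
    stay below \<open>\<eta> / 2\<close>.\<close>
  define s where "s = \<eta> / (12 * (L + 1))"
  have s: "0 < s" "2 * (L * (3 * s)) \<le> \<eta> / 2"
    using L \<eta> by (auto simp: s_def field_simps)
  \<comment> \<open>The \<open>+ 1\<close> makes \<open>K\<close> positive and the inequality
    demanded by \<open>truncation\<close> strict.\<close>
  define K where "K = 2 * C / \<delta> s + 1"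
  have K: "0 < K" "2 * C / K < \<delta> s"
    using C \<delta>[OF s(1)] by (auto simp: K_def field_simps add_pos_nonneg add_nonneg_pos)
  have "\<exists>P c. is_part \<Omega> P \<and> (\<forall>E\<in>P. \<bar>c E\<bar> \<le> L) \<and>
     (\<forall>\<mu>\<in>ba \<Omega> \<A>. (\<forall>A\<in>\<A>. \<bar>\<mu> A\<bar> \<le> K * m A) \<longrightarrow> \<bar>\<phi> \<mu> - (\<Sum>E\<in>P. c E * \<mu> E)\<bar> \<le> \<eta> / 2)"
    using K(1) \<eta> \<phi>L by (intro dual_approx_dominated[OF m \<phi> L]) auto
  then obtain P c where P: "is_part \<Omega> P" and c: "\<And>E. E \<in> P \<Longrightarrow> \<bar>c E\<bar> \<le> L"
    and approx: "\<And>\<nu>. \<nu> \<in> ba \<Omega> \<A> \<Longrightarrow> \<forall>A\<in>\<A>. \<bar>\<nu> A\<bar> \<le> K * m A \<Longrightarrow>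
        \<bar>\<phi> \<nu> - (\<Sum>E\<in>P. c E * \<nu> E)\<bar> \<le> \<eta> / 2"
    by blast
  have "\<bar>\<phi> \<mu> - (\<Sum>E\<in>P. c E * \<mu> E)\<bar> \<le> \<eta>" if "\<mu> \<in> uac_ball m C \<delta>" for \<mu>
  proof -
    have \<mu>: "\<mu> \<in> ba \<Omega> \<A>" and bound: "\<And>A. A \<in> \<A> \<Longrightarrow> \<bar>\<mu> A\<bar> \<le> C"
      and ac: "\<And>A. A \<in> \<A> \<Longrightarrow> m A < \<delta> s \<Longrightarrow> \<bar>\<mu> A\<bar> \<le> s"
      using that uac_ball_ba s(1) by (auto simp: uac_ball_def)
    obtain \<nu> where \<nu>: "\<nu> \<in> ba \<Omega> \<A>" "\<forall>A\<in>\<A>. \<bar>\<nu> A\<bar> \<le> K * m A"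
      and dist: "tvar \<A> (\<lambda>B. 1 * \<mu> B + (-1) * \<nu> B) \<Omega> \<le> 3 * s"
      by (rule truncation[OF \<mu> m K(1) bound ac less_imp_le[OF s(1)] K(2)])
    let ?d = "\<lambda>B. 1 * \<mu> B + (-1) * \<nu> B"
    have d: "?d \<in> ba \<Omega> \<A>"
      by (rule ba_lincomb[OF \<mu> \<nu>(1)])
    have Ld: "L * tvar \<A> ?d \<Omega> \<le> L * (3 * s)"
      using L dist by (intro mult_left_mono)
    have "\<bar>\<phi> \<mu> - \<phi> \<nu>\<bar> \<le> L * (3 * s)"
      using \<phi>L[OF d] Ld dual_lincomb[OF \<phi> \<mu> \<nu>(1), of 1 "-1"] by simp
    moreover have "\<bar>(\<Sum>E\<in>P. c E * \<mu> E) - (\<Sum>E\<in>P. c E * \<nu> E)\<bar> \<le> L * (3 * s)"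
      using part_comb_le[OF ba_bfa[OF d] P, of c L] c L Ld by (simp add: sum_subtractf right_diff_distrib)
    ultimately show ?thesis
      using approx[OF \<nu>] s(2) by linarith
  qed
  then show ?thesis
    by blast
qed

text \<open>Each defining condition is an equation or non-strict inequality in finitely many
  evaluations, so the ball is closed in a Tychonoff box.\<close>

lemma compact_uac_ball: "compact (uac_ball m C \<delta>)"
proof (cases "0 \<le> C")
  case True
  have "uac_ball m C \<delta> = {\<mu>. \<forall>B. B \<notin> \<A> \<longrightarrow> \<mu> B = 0} \<inter>
      {\<mu>. \<forall>A B. A \<in> \<A> \<and> B \<in> \<A> \<and> A \<inter> B = {} \<longrightarrow> \<mu> (A \<union> B) = \<mu> A + \<mu> B} \<inter>
      {\<mu>. \<forall>B. B \<in> \<A> \<longrightarrow> \<bar>\<mu> B\<bar> \<le> C} \<inter> {\<mu>. \<forall>\<epsilon> A. 0 < \<epsilon> \<and> A \<in> \<A> \<and> m A < \<delta> \<epsilon> \<longrightarrow> \<bar>\<mu> A\<bar> \<le> \<epsilon>}"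
    by (auto simp: uac_ball_def fin_additive_def)
  moreover have "closed \<dots>"
    by (intro closed_Int closed_Collect_all closed_Collect_imp open_Collect_const closed_Collect_eval)
  ultimately have "closed (uac_ball m C \<delta>)"
    by simp
  moreover have "uac_ball m C \<delta> \<subseteq> {g. \<forall>x. g x \<in> {-C..C}}"
  proof
    fix \<mu> assume \<mu>: "\<mu> \<in> uac_ball m C \<delta>"
    have "\<bar>\<mu> B\<bar> \<le> C" for B
      using \<mu> True by (cases "B \<in> \<A>") (auto simp: uac_ball_def)
    then show "\<mu> \<in> {g. \<forall>x. g x \<in> {-C..C}}"
      by (simp add: abs_le_iff minus_le_iff)
  qed
  ultimately show ?thesis
    using compact_Int_closed[OF compact_function_box, of "uac_ball m C \<delta>"] by (metis inf.absorb2)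
next
  case False
  then have "uac_ball m C \<delta> = {}"
    by (force simp: uac_ball_def)
  then show ?thesis
    by simp
qed

lemma continuous_on_dual_uac_ball:
  assumes m: "nonneg m" and \<phi>: "\<phi> \<in> ba_dual \<Omega> \<A>" and C: "0 \<le> C" and \<delta>: "\<And>\<epsilon>. 0 < \<epsilon> \<Longrightarrow> 0 < \<delta> \<epsilon>"
  shows "continuous_on (uac_ball m C \<delta>) \<phi>"
proof -
  have "\<forall>n. \<exists>P c. \<forall>\<mu>\<in>uac_ball m C \<delta>. \<bar>\<phi> \<mu> - (\<Sum>E\<in>P. c E * \<mu> E)\<bar> \<le> inverse (real (Suc n))"
    using dual_approx_uac[OF m \<phi> C \<delta>] by simp
  then obtain P c where approx: "\<And>n \<mu>. \<mu> \<in> uac_ball m C \<delta> \<Longrightarrow>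
      \<bar>\<phi> \<mu> - (\<Sum>E\<in>P n. c n E * \<mu> E)\<bar> \<le> inverse (real (Suc n))"
    by metis
  have "continuous_on (uac_ball m C \<delta>) (\<lambda>\<mu>. \<Sum>E\<in>P n. c n E * \<mu> E)" for n
    by (intro continuous_on_sum continuous_on_mult continuous_on_const
        continuous_on_subset[OF continuous_on_product_coordinates]) auto
  moreover have "uniform_limit (uac_ball m C \<delta>) (\<lambda>n \<mu>. \<Sum>E\<in>P n. c n E * \<mu> E) \<phi> sequentially"
  proof (rule uniform_limitI)
    fix e :: real assume "0 < e"
    then have "eventually (\<lambda>n. inverse (real (Suc n)) < e) sequentially"
      using LIMSEQ_inverse_real_of_nat by (intro order_tendstoD(2)[of _ 0])
    then show "eventually (\<lambda>n. \<forall>\<mu>\<in>uac_ball m C \<delta>. dist (\<Sum>E\<in>P n. c n E * \<mu> E) (\<phi> \<mu>) < e) sequentially"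
      by eventually_elim (use approx in \<open>auto simp: dist_real_def abs_minus_commute intro: le_less_trans\<close>)
  qed
  ultimately show ?thesis
    by (intro uniform_limit_theorem[where F = sequentially]) auto
qed

text \<open>The identity on the ball, from the setwise to the weak topology, is continuous because
  this can be checked on the generating sets; it carries compactness over.\<close>

lemma compactin_uac_ball:
  assumes m: "nonneg m" and C: "0 \<le> C" and \<delta>: "\<And>\<epsilon>. 0 < \<epsilon> \<Longrightarrow> 0 < \<delta> \<epsilon>"
  shows "compactin (ba_weak \<Omega> \<A>) (uac_ball m C \<delta>)"
proof -
  let ?B = "uac_ball m C \<delta>"
  let ?S = "{{\<mu> \<in> ba \<Omega> \<A>. \<phi> \<mu> \<in> U} | \<phi> U. \<phi> \<in> ba_dual \<Omega> \<A> \<and> open U}"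
  have "continuous_map (top_of_set ?B) (topology_generated_by ?S) (\<lambda>\<mu>. \<mu>)"
  proof (rule continuous_on_generated_topo)
    fix W assume "W \<in> ?S"
    then obtain \<phi> U where W: "W = {\<mu> \<in> ba \<Omega> \<A>. \<phi> \<mu> \<in> U}" "\<phi> \<in> ba_dual \<Omega> \<A>" "open U"
      by blast
    have "continuous_on ?B \<phi>"
      using \<delta> by (rule continuous_on_dual_uac_ball[OF m W(2) C])
    then have "openin (top_of_set ?B) (?B \<inter> \<phi> -` U)"
      using W(3) by (rule continuous_openin_preimage_gen)
    moreover have "(\<lambda>\<mu>. \<mu>) -` W \<inter> topspace (top_of_set ?B) = ?B \<inter> \<phi> -` U"
      using uac_ball_ba by (auto simp: W(1))
    ultimately show "openin (top_of_set ?B) ((\<lambda>\<mu>. \<mu>) -` W \<inter> topspace (top_of_set ?B))"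
      by simp
  next
    show "(\<lambda>\<mu>. \<mu>) ` topspace (top_of_set ?B) \<subseteq> \<Union>?S"
      using uac_ball_ba topspace_ba_weak unfolding ba_weak_def topology_generated_by_topspace by auto
  qed
  then have "compactin (topology_generated_by ?S) ((\<lambda>\<mu>. \<mu>) ` ?B)"
    using compact_uac_ball by (intro image_compactin[of "top_of_set ?B"]) auto
  then show ?thesis
    by (simp add: ba_weak_def)
qed

text \<open>Evaluations belong to the dual, so the weak closure of \<open>M\<close> obeys the same
  non-strict bounds and stays in a compact ball.\<close>

lemma uac_imp_rel_weakly_compact:
  assumes M: "M \<subseteq> ba \<Omega> \<A>" and bdd: "\<And>\<mu>. \<mu> \<in> M \<Longrightarrow> ba_norm \<Omega> \<A> \<mu> \<le> C" and m: "nonneg m"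
    and ac: "\<And>\<epsilon>. 0 < \<epsilon> \<Longrightarrow> \<exists>\<delta>>0. \<forall>A\<in>\<A>. m A < \<delta> \<longrightarrow> (\<forall>\<mu>\<in>M. tvar \<A> \<mu> A < \<epsilon>)"
  shows "rel_weakly_compact \<Omega> \<A> M"
proof -
  let ?X = "ba_weak \<Omega> \<A>" and ?C = "max C 0"
  obtain \<delta> where \<delta>: "\<And>\<epsilon>. 0 < \<epsilon> \<Longrightarrow> 0 < \<delta> \<epsilon>"
    and small: "\<And>\<epsilon> A \<mu>. 0 < \<epsilon> \<Longrightarrow> A \<in> \<A> \<Longrightarrow> m A < \<delta> \<epsilon> \<Longrightarrow> \<mu> \<in> M \<Longrightarrow> tvar \<A> \<mu> A < \<epsilon>"
    using ac by metis
  have closure: "\<bar>g A\<bar> \<le> c" if A: "A \<in> \<A>" and g: "g \<in> ?X closure_of M" and le: "\<And>\<mu>. \<mu> \<in> M \<Longrightarrow> \<bar>\<mu> A\<bar> \<le> c" for g A c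
  proof -
    have "closed {t::real. \<bar>t\<bar> \<le> c}"
      by (intro closed_Collect_le continuous_intros)
    then have "closedin ?X {\<mu> \<in> ba \<Omega> \<A>. \<mu> A \<in> {t. \<bar>t\<bar> \<le> c}}"
      by (rule closedin_ba_weak[OF eval_in_dual[OF A]])
    moreover have "M \<subseteq> {\<mu> \<in> ba \<Omega> \<A>. \<mu> A \<in> {t. \<bar>t\<bar> \<le> c}}"
      using M le by auto
    ultimately show ?thesis
      using closure_of_minimal g by blast
  qed
  have "?X closure_of M \<subseteq> uac_ball m ?C \<delta>"
  proof
    fix g assume g: "g \<in> ?X closure_of M"
    have "g \<in> ba \<Omega> \<A>"
      using g closure_of_subset_topspace[of ?X M] by auto
    moreover have "\<bar>g A\<bar> \<le> ?C" if "A \<in> \<A>" for A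
    proof (rule closure[OF that g])
      fix \<mu> assume "\<mu> \<in> M"
      then show "\<bar>\<mu> A\<bar> \<le> ?C"
        using abs_le_tvar[OF ba_bfa that] ba_norm_bound[OF _ that] bdd M by (smt (verit) subsetD)
    qed
    moreover have "\<bar>g A\<bar> \<le> \<epsilon>" if "0 < \<epsilon>" "A \<in> \<A>" "m A < \<delta> \<epsilon>" for \<epsilon> A
    proof (rule closure[OF that(2) g])
      fix \<mu> assume "\<mu> \<in> M"
      then show "\<bar>\<mu> A\<bar> \<le> \<epsilon>"
        using abs_le_tvar[OF ba_bfa that(2)] small[OF that] M by (smt (verit) subsetD)
    qed
    ultimately show "g \<in> uac_ball m ?C \<delta>"
      by (auto simp: uac_ball_def ba_def)
  qed
  moreover have "compactin ?X (uac_ball m ?C \<delta>)"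
    using \<delta> by (intro compactin_uac_ball[OF m]) auto
  ultimately have "compactin ?X (?X closure_of M)"
    using closed_compactin[OF _ _ closedin_closure_of] by blast
  then show ?thesis
    using M by (simp add: rel_weakly_compact_def)
qed

end

section \<open>Assembly of the equivalences through uniform strong additivity\<close>

theorem mainTheorem5:
  fixes \<Omega> :: "'a set" and \<A> :: "'a set set" and M :: "('a set \<Rightarrow> real) set"
  assumes alg: "algebra \<Omega> \<A>"
    and M_ba: "M \<subseteq> ba \<Omega> \<A>"
    and M_ne: "M \<noteq> {}"
    and M_bdd: "\<exists>C. \<forall>\<mu>\<in>M. ba_norm \<Omega> \<A> \<mu> \<le> C"
  defines "c1 \<equiv> (\<exists>m\<in>convA \<Omega> \<A> M. \<forall>\<epsilon>>0. \<exists>\<delta>>0. \<forall>A\<in>\<A>.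
                   m A < \<delta> \<longrightarrow> (\<forall>\<mu>\<in>M. tvar \<A> \<mu> A < \<epsilon>))"
    and "c2 \<equiv> rel_weakly_compact \<Omega> \<A> M"
    and "c3 \<equiv> (\<forall>A::nat \<Rightarrow> 'a set. range A \<subseteq> \<A> \<longrightarrow> (mono A \<or> antimono A) \<longrightarrow>
                (\<exists>L. \<forall>\<epsilon>>0. \<exists>N. \<forall>n\<ge>N. \<forall>\<mu>\<in>M. \<bar>tvar \<A> \<mu> (A n) - L \<mu>\<bar> < \<epsilon>))"
    and "c4 \<equiv> (\<forall>M0 \<subseteq> M. \<forall>A::nat \<Rightarrow> 'a set. range A \<subseteq> \<A> \<longrightarrow>
                (\<forall>\<mu>\<in>M0. \<exists>L::nat \<Rightarrow> real.
                   (\<forall>j. (\<lambda>k. tvar \<A> \<mu> (\<Union>n\<in>{j..j+k}. A n)) \<longlonglongrightarrow> L j) \<and> L \<longlonglongrightarrow> 0) \<longrightarrow>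
                (\<forall>\<epsilon>>0. \<exists>N. \<forall>n\<ge>N. \<forall>\<mu>\<in>M0. \<bar>\<mu> (A n)\<bar> < \<epsilon>))"
    and "c5 \<equiv> (\<forall>M0 \<subseteq> M. \<forall>lam\<in>ba \<Omega> \<A>. (\<forall>\<mu>\<in>M0. abs_cont \<A> \<mu> lam) \<longrightarrow>
                (\<forall>\<epsilon>>0. \<exists>\<delta>>0. \<forall>A\<in>\<A>. tvar \<A> lam A < \<delta> \<longrightarrow> (\<forall>\<mu>\<in>M0. tvar \<A> \<mu> A < \<epsilon>)))"
    and "c6 \<equiv> (\<forall>M0 \<subseteq> M. \<forall>lam\<in>ba \<Omega> \<A>. (\<forall>\<mu>\<in>M0. orth \<Omega> \<A> lam \<mu>) \<longrightarrow>
                (\<forall>\<epsilon>>0. \<exists>A\<in>\<A>. \<exists>s\<ge>0. (\<forall>\<mu>\<in>M0. tvar \<A> \<mu> A \<le> s) \<and>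
                    s + tvar \<A> lam (\<Omega> - A) < \<epsilon>))"
  shows "(c1 \<longleftrightarrow> c2) \<and> (c2 \<longleftrightarrow> c3) \<and> (c3 \<longleftrightarrow> c4) \<and> (c4 \<longleftrightarrow> c5) \<and> (c5 \<longrightarrow> c6) \<and>
         (sigma_algebra \<Omega> \<A> \<and> M \<subseteq> ca \<Omega> \<A> \<longrightarrow> c6 \<longrightarrow> c3)"
proof -
  interpret set_alg \<Omega> \<A>
    using alg by (simp add: set_alg_def)
  obtain C where C: "\<And>\<mu>. \<mu> \<in> M \<Longrightarrow> ba_norm \<Omega> \<A> \<mu> \<le> C"
    using M_bdd by blast
  have c1: "c1 \<longleftrightarrow> usa M"
  proof
    assume c1
    then obtain m where m: "m \<in> convA \<Omega> \<A> M"
      and ac: "\<forall>\<epsilon>>0. \<exists>\<delta>>0. \<forall>A\<in>\<A>. m A < \<delta> \<longrightarrow> (\<forall>\<mu>\<in>M. tvar \<A> \<mu> A < \<epsilon>)"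
      unfolding c1_def by blast
    show "usa M"
      using ac by (intro usa_if_abs_cont[OF convA_nonneg[OF M_ba m]]) simp
  next
    assume "usa M"
    then show c1
      unfolding c1_def using M_ba M_ne by (rule usa_imp_convA)
  qed
  have c2: "c2 \<longleftrightarrow> usa M"
  proof
    assume c2
    then show "usa M"
      unfolding c2_def using C by (rule rel_weakly_compact_imp_usa)
  next
    assume "usa M"
    then obtain m where m: "m \<in> convA \<Omega> \<A> M"
      and ac: "\<forall>\<epsilon>>0. \<exists>\<delta>>0. \<forall>A\<in>\<A>. m A < \<delta> \<longrightarrow> (\<forall>\<mu>\<in>M. tvar \<A> \<mu> A < \<epsilon>)"
      using usa_imp_convA[OF _ M_ba M_ne] by blast
    show c2
      unfolding c2_def using ac by (intro uac_imp_rel_weakly_compact[OF M_ba C convA_nonneg[OF M_ba m]]) simp_all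
  qed
  have c3: "c3 \<longleftrightarrow> usa M"
  proof
    assume c3
    then show "usa M"
      unfolding c3_def by (intro mono_cont_imp_usa[OF M_ba]) simp
  next
    assume "usa M"
    then show c3
      unfolding c3_def using usa_imp_mono_cont[OF _ M_ba] by simp
  qed
  have c4: "c4 \<longleftrightarrow> usa M"
  proof
    assume c4
    then show "usa M"
      unfolding c4_def by (intro unif_tendsto_imp_usa[OF M_ba]) simp
  next
    assume "usa M"
    then show c4
      unfolding c4_def using usa_imp_unif_tendsto[OF usa_subset subset_trans[OF _ M_ba]] by simp
  qed
  have c5: "c5 \<longleftrightarrow> usa M"
  proof
    assume c5
    then show "usa M"
      unfolding c5_def by (intro uac_imp_usa[OF M_ba]) simp
  next
    assume "usa M"
    then show c5
      unfolding c5_def using usa_imp_uac[OF usa_subset subset_trans[OF _ M_ba]] by simp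
  qed
  have c6: "c6" if "usa M"
    using that unfolding c6_def using usa_imp_unif_orth[OF usa_subset subset_trans[OF _ M_ba]] by simp
  have c6': "usa M" if "sigma_algebra \<Omega> \<A>" "M \<subseteq> ca \<Omega> \<A>" c6
    using that(3) unfolding c6_def by (intro unif_orth_imp_usa[OF that(2,1)]) simp
  show ?thesis
    using c1 c2 c3 c4 c5 c6 c6' by blast
qed

end
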